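(* The category $\mathbf{ZComp}$ of zero-dimensional Hausdorff compactifications and the category $\mathbf{zBoole}$ of Boolean z-algebras are dually equivalent.
   Context: Boolean algebras with $0=1$ are allowed. $\mathbf{2}=\{0,1\}$ is the two-element Boolean algebra; $\mathbf{Boole}(A,\mathbf 2)$ is the set of Boolean homomorphisms $A\to\mathbf 2$. A Hausdorff compactification is a map $c:X\to Y$ which is a dense embedding of a space $X$ into a compact Hausdorff space $Y$. $\mathbf{Comp}$ is the category whose objects are all Hausdorff compactifications $c:X\to Y$ and whose morphisms from $c:X\to Y$ to $c':X'\to Y'$ are all pairs $(f,g)$ of continuous maps $f:X\to X'$, $g:Y\to Y'$ with $g\circ c=c'\circ f$; composition is componentwise and identities are $(id_X,id_Y)$. $\mathbf{ZComp}$ is the full subcategory of $\mathbf{Comp}$ whose objects are those $c:X\to Y$ for which $Y$ is zero-dimensional (has a base of clopen sets). A Boolean z-algebra is a pair $(A,X)$, where $A$ is a Boolean algebra and $X\subseteq\mathbf{Boole}(A,\mathbf 2)$, such that for each $a\in A\setminus\{0\}$ there is $x\in X$ with $x(a)=1$. $\mathbf{zBoole}$ is the category whose objects are all Boolean z-algebras and whose morphisms $(A,X)\to(A',X')$ are all pairs $(\varphi,f)$ with $\varphi:A\to A'$ a Boolean homomorphism and $f:X'\to X$ a function such that $x'\circ\varphi=f(x')$ for every $x'\in X'$; composition is $(\varphi',f')\circ(\varphi,f)=(\varphi'\circ\varphi,f\circ f')$ and identities are $(id_A,id_X)$. Two categories are dually equivalent if there are contravariant functors between them in both directions whose two composites are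 naturally isomorphic to the identity functors. *)

theory Defs
  imports "HOL-Analysis.Analysis" "HOL-Algebra.Lattice" "HOL-Library.Equipollence"
begin

section \<open>Categories and dual equivalence\<close>

text \<open>
  Hom-sets are indexed by domain and codomain and need not be disjoint; therefore
  composition takes the three objects involved: \<open>cmp C a b c g f\<close> is
  \<open>g \<circ> f\<close> for \<open>f : a \<rightarrow> b\<close> and \<open>g : b \<rightarrow> c\<close>.
\<close>

record ('o, 'm) cat =
  obj :: "'o set"
  arr :: "'o \<Rightarrow> 'o \<Rightarrow> 'm set"
  cmp :: "'o \<Rightarrow> 'o \<Rightarrow> 'o \<Rightarrow> 'm \<Rightarrow> 'm \<Rightarrow> 'm"
  ident :: "'o \<Rightarrow> 'm"

locale category =
  fixes C :: "('o, 'm) cat"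
  assumes ident_arr: "a \<in> obj C \<Longrightarrow> ident C a \<in> arr C a a"
    and cmp_arr:
      "\<lbrakk>a \<in> obj C; b \<in> obj C; c \<in> obj C; f \<in> arr C a b; g \<in> arr C b c\<rbrakk>
        \<Longrightarrow> cmp C a b c g f \<in> arr C a c"
    and cmp_ident_right:
      "\<lbrakk>a \<in> obj C; b \<in> obj C; f \<in> arr C a b\<rbrakk> \<Longrightarrow> cmp C a a b f (ident C a) = f"
    and cmp_ident_left:
      "\<lbrakk>a \<in> obj C; b \<in> obj C; f \<in> arr C a b\<rbrakk> \<Longrightarrow> cmp C a b b (ident C b) f = f"
    and cmp_assoc:
      "\<lbrakk>a \<in> obj C; b \<in> obj C; c \<in> obj C; d \<in> obj C;
        f \<in> arr C a b; g \<in> arr C b c; h \<in> arr C c d\<rbrakk>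
        \<Longrightarrow> cmp C a c d h (cmp C a b c g f) = cmp C a b d (cmp C b c d h g) f"

definition full_subcategory :: "('o, 'm) cat \<Rightarrow> ('o \<Rightarrow> bool) \<Rightarrow> ('o, 'm) cat" where
  "full_subcategory C P = C\<lparr>obj := {a \<in> obj C. P a}\<rparr>"

definition isomorphism :: "('o, 'm) cat \<Rightarrow> 'o \<Rightarrow> 'o \<Rightarrow> 'm \<Rightarrow> bool" where
  "isomorphism C a b f \<longleftrightarrow> f \<in> arr C a b \<and>
     (\<exists>g \<in> arr C b a. cmp C a b a g f = ident C a \<and> cmp C b a b f g = ident C b)"

record ('o, 'm, 'p, 'n) functor_data =
  on_obj :: "'o \<Rightarrow> 'p"
  on_arr :: "'o \<Rightarrow> 'o \<Rightarrow> 'm \<Rightarrow> 'n"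

definition covariant_functor ::
    "('o, 'm) cat \<Rightarrow> ('p, 'n) cat \<Rightarrow> ('o, 'm, 'p, 'n) functor_data \<Rightarrow> bool" where
  "covariant_functor C D F \<longleftrightarrow>
     (\<forall>a \<in> obj C. on_obj F a \<in> obj D) \<and>
     (\<forall>a \<in> obj C. \<forall>b \<in> obj C. \<forall>f \<in> arr C a b.
        on_arr F a b f \<in> arr D (on_obj F a) (on_obj F b)) \<and>
     (\<forall>a \<in> obj C. on_arr F a a (ident C a) = ident D (on_obj F a)) \<and>
     (\<forall>a \<in> obj C. \<forall>b \<in> obj C. \<forall>c \<in> obj C. \<forall>f \<in> arr C a b. \<forall>g \<in> arr C b c.
        on_arr F a c (cmp C a b c g f) =
        cmp D (on_obj F a) (on_obj F b) (on_obj F c) (on_arr F b c g) (on_arr F a b f))"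

definition contravariant_functor ::
    "('o, 'm) cat \<Rightarrow> ('p, 'n) cat \<Rightarrow> ('o, 'm, 'p, 'n) functor_data \<Rightarrow> bool" where
  "contravariant_functor C D F \<longleftrightarrow>
     (\<forall>a \<in> obj C. on_obj F a \<in> obj D) \<and>
     (\<forall>a \<in> obj C. \<forall>b \<in> obj C. \<forall>f \<in> arr C a b.
        on_arr F a b f \<in> arr D (on_obj F b) (on_obj F a)) \<and>
     (\<forall>a \<in> obj C. on_arr F a a (ident C a) = ident D (on_obj F a)) \<and>
     (\<forall>a \<in> obj C. \<forall>b \<in> obj C. \<forall>c \<in> obj C. \<forall>f \<in> arr C a b. \<forall>g \<in> arr C b c.
        on_arr F a c (cmp C a b c g f) =
        cmp D (on_obj F c) (on_obj F b) (on_obj F a) (on_arr F a b f) (on_arr F b c g))"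

definition identity_functor :: "('o, 'm, 'o, 'm) functor_data" where
  "identity_functor = \<lparr>on_obj = (\<lambda>a. a), on_arr = (\<lambda>a b f. f)\<rparr>"

definition contravariant_composite ::
    "('p, 'n, 'q, 'l) functor_data \<Rightarrow> ('o, 'm, 'p, 'n) functor_data
      \<Rightarrow> ('o, 'm, 'q, 'l) functor_data" where
  "contravariant_composite G F =
     \<lparr>on_obj = (\<lambda>a. on_obj G (on_obj F a)),
      on_arr = (\<lambda>a b f. on_arr G (on_obj F b) (on_obj F a) (on_arr F a b f))\<rparr>"

definition naturally_isomorphic ::
    "('o, 'm) cat \<Rightarrow> ('p, 'n) cat \<Rightarrow> ('o, 'm, 'p, 'n) functor_data
      \<Rightarrow> ('o, 'm, 'p, 'n) functor_data \<Rightarrow> bool" where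
  "naturally_isomorphic C D F G \<longleftrightarrow>
     covariant_functor C D F \<and> covariant_functor C D G \<and>
     (\<exists>\<eta>. (\<forall>a \<in> obj C. isomorphism D (on_obj F a) (on_obj G a) (\<eta> a)) \<and>
          (\<forall>a \<in> obj C. \<forall>b \<in> obj C. \<forall>f \<in> arr C a b.
             cmp D (on_obj F a) (on_obj F b) (on_obj G b) (\<eta> b) (on_arr F a b f) =
             cmp D (on_obj F a) (on_obj G a) (on_obj G b) (on_arr G a b f) (\<eta> a)))"

definition dually_equivalent :: "('o, 'm) cat \<Rightarrow> ('p, 'n) cat \<Rightarrow> bool" where
  "dually_equivalent C D \<longleftrightarrow> category C \<and> category D \<and>
     (\<exists>F G. contravariant_functor C D F \<and> contravariant_functor D C G \<and>
        naturally_isomorphic C C (contravariant_composite G F) identity_functor \<and>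
        naturally_isomorphic D D (contravariant_composite F G) identity_functor)"


section \<open>The universe\<close>

text \<open>
  A category of all spaces or of all algebras needs a universe. Here it is the type
  \<open>'u\<close>: the underlying sets are the subsets of \<open>'u\<close> of cardinality smaller
  than that of \<open>'u\<close>. The universe is adequate if these sets are closed
  under power sets up to equipollence, i.e. if the cardinality of \<open>'u\<close> is a
  strong limit. If \<open>'u\<close> is equinumerous with a Grothendieck universe \<open>U\<close>,
  this holds, and the small sets are those equipollent to an element of \<open>U\<close>.
\<close>

definition small :: "'u set \<Rightarrow> bool" where
  "small S \<longleftrightarrow> S \<prec> (UNIV :: 'u set)"

definition power_closed_universe :: "'u itself \<Rightarrow> bool" where
  "power_closed_universe TYPE('u) \<longleftrightarrow>
     (\<forall>S :: 'u set. small S \<longrightarrow> Pow S \<prec> (UNIV :: 'u set))"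


section \<open>Hausdorff compactifications\<close>

text \<open>
  The triple \<open>(X, Y, c)\<close> stands for \<open>c : X \<rightarrow> Y\<close>. Maps are represented by
  functions that are \<open>undefined\<close> outside their domain, so that equality of
  morphisms is equality of functions.
\<close>

type_synonym 'u compactification = "'u topology \<times> 'u topology \<times> ('u \<Rightarrow> 'u)"

definition hausdorff_compactification :: "'u compactification \<Rightarrow> bool" where
  "hausdorff_compactification = (\<lambda>(X, Y, c).
     compact_space Y \<and> Hausdorff_space Y \<and>
     c \<in> extensional (topspace X) \<and> embedding_map X Y c \<and>
     Abstract_Topology.closure_of Y (c ` topspace X) = topspace Y)"

definition zero_dimensional :: "'a topology \<Rightarrow> bool" where
  "zero_dimensional Y \<longleftrightarrow>
     (\<exists>\<B>. (\<forall>U \<in> \<B>. openin Y U \<and> closedin Y U) \<and>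
          openin Y = arbitrary union_of (\<lambda>U. U \<in> \<B>))"

definition Comp :: "('u compactification, ('u \<Rightarrow> 'u) \<times> ('u \<Rightarrow> 'u)) cat" where
  "Comp = \<lparr>
     obj = {(X, Y, c). small (topspace X) \<and> small (topspace Y) \<and>
                       hausdorff_compactification (X, Y, c)},
     arr = (\<lambda>(X, Y, c) (X', Y', c'). {(f, g).
              f \<in> extensional (topspace X) \<and> continuous_map X X' f \<and>
              g \<in> extensional (topspace Y) \<and> continuous_map Y Y' g \<and>
              (\<forall>x \<in> topspace X. g (c x) = c' (f x))}),
     cmp = (\<lambda>(X, Y, c) _ _ (f', g') (f, g).
              (compose (topspace X) f' f, compose (topspace Y) g' g)),
     ident = (\<lambda>(X, Y, c). (\<lambda>x \<in> topspace X. x, \<lambda>y \<in> topspace Y. y))\<rparr>"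

definition ZComp :: "('u compactification, ('u \<Rightarrow> 'u) \<times> ('u \<Rightarrow> 'u)) cat" where
  "ZComp = full_subcategory Comp (\<lambda>(X, Y, c). zero_dimensional Y)"


section \<open>Boolean z-algebras\<close>

text \<open>
  A Boolean algebra is a complemented distributive bounded lattice; the bounds may coincide.
\<close>

locale boolean_lattice = bounded_lattice L for L :: "'a gorder" (structure) +
  assumes distrib:
      "\<lbrakk>x \<in> carrier L; y \<in> carrier L; z \<in> carrier L\<rbrakk>
        \<Longrightarrow> x \<sqinter> (y \<squnion> z) = (x \<sqinter> y) \<squnion> (x \<sqinter> z)"
    and complemented:
      "x \<in> carrier L \<Longrightarrow> \<exists>y \<in> carrier L. x \<squnion> y = \<top> \<and> x \<sqinter> y = \<bottom>"

text \<open>Preservation of complements follows from that of joins, meets and the bounds.\<close>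

definition boolean_hom :: "'a gorder \<Rightarrow> 'b gorder \<Rightarrow> ('a \<Rightarrow> 'b) set" where
  "boolean_hom A B = {\<phi> \<in> carrier A \<rightarrow>\<^sub>E carrier B.
     join_pres A B \<phi> \<and> meet_pres A B \<phi> \<and> \<phi> \<bottom>\<^bsub>A\<^esub> = \<bottom>\<^bsub>B\<^esub> \<and> \<phi> \<top>\<^bsub>A\<^esub> = \<top>\<^bsub>B\<^esub>}"

text \<open>The two-element Boolean algebra, with \<open>False\<close> as 0 and \<open>True\<close> as 1.\<close>

definition two :: "bool gorder" where
  "two = \<lparr>carrier = UNIV, eq = (=), le = (\<le>)\<rparr>"

type_synonym 'u zalgebra = "'u gorder \<times> ('u \<Rightarrow> bool) set"

definition boolean_zalgebra :: "'u zalgebra \<Rightarrow> bool" where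
  "boolean_zalgebra = (\<lambda>(A, X).
     boolean_lattice A \<and> X \<subseteq> boolean_hom A two \<and>
     (\<forall>a \<in> carrier A - {\<bottom>\<^bsub>A\<^esub>}. \<exists>x \<in> X. x a = True))"

definition zBoole ::
    "('u zalgebra, ('u \<Rightarrow> 'u) \<times> (('u \<Rightarrow> bool) \<Rightarrow> ('u \<Rightarrow> bool))) cat" where
  "zBoole = \<lparr>
     obj = {(A, X). small (carrier A) \<and> boolean_zalgebra (A, X)},
     arr = (\<lambda>(A, X) (A', X'). {(\<phi>, f).
              \<phi> \<in> boolean_hom A A' \<and> f \<in> X' \<rightarrow>\<^sub>E X \<and>
              (\<forall>x' \<in> X'. compose (carrier A) x' \<phi> = f x')}),
     cmp = (\<lambda>(A, X) _ (A'', X'') (\<phi>', f') (\<phi>, f).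
              (compose (carrier A) \<phi>' \<phi>, compose X'' f f')),
     ident = (\<lambda>(A, X). (\<lambda>a \<in> carrier A. a, \<lambda>x \<in> X. x))\<rparr>"

end

theory Submission
  imports Defs
begin

text \<open>
  A compactification \<open>c : X \<rightarrow> Y\<close> is sent to the algebra of clopen subsets of \<open>Y\<close> together with
  the evaluations at the points \<open>c x\<close>; density of \<open>c\<close> says exactly that these evaluations detect
  nonzero elements. This contravariant functor is fully faithful: by compactness every Boolean
  homomorphism from the clopen sets to \<open>2\<close> is evaluation at a point, so a homomorphism of clopen
  algebras is the preimage under a unique continuous map, and compatibility with the distinguished
  points makes that map restrict to the dense subspaces. It is essentially surjective: a z-algebra
  \<open>(A, X)\<close> comes from \<open>X\<close> inside the Stone space of \<open>A\<close>, a closed subspace of a power of \<open>2\<close>.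
\<close>

section \<open>Fully faithful and essentially surjective functors\<close>

text \<open>A clopen set is a subset of \<open>'u\<close> and a homomorphism to \<open>two\<close>
  is a function on \<open>'u\<close>, yet algebras need carriers in \<open>'u\<close> and spaces
  need points in \<open>'u\<close>. Both kinds of object are therefore transported along chosen
  injections into \<open>'u\<close>. Closure of the small sets under power sets supplies these
  injections and keeps the results small: clopen sets are found in the power set of the space, and
  homomorphisms embed in the power set of the algebra.

  No explicit formula for the inverse functor is needed. Choosing one preimage and one isomorphism
  per object determines it by full faithfulness, so Stone spaces enter only object by object.

  The usual appeal to prime ideals, to show that an element of the algebra is determined by the
  clopen set it defines, does not occur: the distinguished homomorphisms of a z-algebra detect
  nonzero elements and therefore separate elements.\<close>

lemma category_full_subcategory:
  assumes "category C"
  shows "category (full_subcategory C P)"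
  using assms unfolding category_def full_subcategory_def by simp

lemma covariant_identity_functor: "covariant_functor C C identity_functor"
  by (simp add: covariant_functor_def identity_functor_def)

lemma covariant_contravariant_composite:
  assumes F: "contravariant_functor C D F" and G: "contravariant_functor D E G"
  shows "covariant_functor C E (contravariant_composite G F)"
  using assms unfolding covariant_functor_def contravariant_functor_def contravariant_composite_def
  by simp

text \<open>The familiar criterion for an equivalence, with the hom-sets reversed on the side of
  \<open>D\<close>. The inverse functor is then obtained by choice.\<close>

locale contravariant_equivalence = C: category C + D: category D
  for C :: "('o, 'm) cat" and D :: "('p, 'n) cat" +
  fixes F :: "('o, 'm, 'p, 'n) functor_data"
  assumes functor_F: "contravariant_functor C D F"
    and fully_faithful:
      "\<lbrakk>a \<in> obj C; b \<in> obj C; h \<in> arr D (on_obj F b) (on_obj F a)\<rbrakk>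
        \<Longrightarrow> \<exists>!f. f \<in> arr C a b \<and> on_arr F a b f = h"
    and essentially_surjective:
      "d \<in> obj D \<Longrightarrow> \<exists>c \<in> obj C. \<exists>e. isomorphism D (on_obj F c) d e"
begin

abbreviation F0 where "F0 \<equiv> on_obj F"
abbreviation F1 where "F1 \<equiv> on_arr F"

lemma F_obj [simp]: "a \<in> obj C \<Longrightarrow> F0 a \<in> obj D"
  and F_arr [simp]: "\<lbrakk>a \<in> obj C; b \<in> obj C; f \<in> arr C a b\<rbrakk> \<Longrightarrow> F1 a b f \<in> arr D (F0 b) (F0 a)"
  and F_ident [simp]: "a \<in> obj C \<Longrightarrow> F1 a a (ident C a) = ident D (F0 a)"
  and F_cmp [simp]: "\<lbrakk>a \<in> obj C; b \<in> obj C; c \<in> obj C; f \<in> arr C a b; g \<in> arr C b c\<rbrakk>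
    \<Longrightarrow> F1 a c (cmp C a b c g f) = cmp D (F0 c) (F0 b) (F0 a) (F1 a b f) (F1 b c g)"
  using functor_F unfolding contravariant_functor_def by auto

declare C.ident_arr [simp] C.cmp_arr [simp] C.cmp_ident_left [simp] C.cmp_ident_right [simp]
declare D.ident_arr [simp] D.cmp_arr [simp] D.cmp_ident_left [simp] D.cmp_ident_right [simp]

text \<open>By this rule equations between arrows of \<open>C\<close> are transferred to
  \<open>D\<close>, where composites with the counit can be computed.\<close>

lemma faithful:
  "\<lbrakk>F1 a b f = F1 a b g; a \<in> obj C; b \<in> obj C; f \<in> arr C a b; g \<in> arr C a b\<rbrakk> \<Longrightarrow> f = g"
  using fully_faithful[of a b "F1 a b f"] by auto

section \<open>The quasi-inverse functor, its counit and its unit\<close>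

definition F_inv :: "'o \<Rightarrow> 'o \<Rightarrow> 'n \<Rightarrow> 'm" where
  "F_inv a b h = (THE f. f \<in> arr C a b \<and> F1 a b f = h)"

lemma F_inv:
  assumes "a \<in> obj C" "b \<in> obj C" "h \<in> arr D (F0 b) (F0 a)"
  shows F_inv_arr [simp]: "F_inv a b h \<in> arr C a b"
    and F_F_inv [simp]: "F1 a b (F_inv a b h) = h"
  using theI'[OF fully_faithful[OF assms]] unfolding F_inv_def by auto

text \<open>One preimage and, below, one isomorphism and one inverse of it are fixed per object, so
  that the same isomorphisms cancel between consecutive arrows.\<close>

definition G0 :: "'p \<Rightarrow> 'o" where
  "G0 d = (SOME c. c \<in> obj C \<and> (\<exists>e. isomorphism D (F0 c) d e))"

definition counit :: "'p \<Rightarrow> 'n" where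
  "counit d = (SOME e. isomorphism D (F0 (G0 d)) d e)"

definition counit_inv :: "'p \<Rightarrow> 'n" where
  "counit_inv d = (SOME e'. e' \<in> arr D d (F0 (G0 d)) \<and>
     cmp D (F0 (G0 d)) d (F0 (G0 d)) e' (counit d) = ident D (F0 (G0 d)) \<and>
     cmp D d (F0 (G0 d)) d (counit d) e' = ident D d)"

context
  fixes d assumes d: "d \<in> obj D"
begin

lemma G0_obj [simp]: "G0 d \<in> obj C" and counit_iso: "isomorphism D (F0 (G0 d)) d (counit d)"
proof -
  have "\<exists>c. c \<in> obj C \<and> (\<exists>e. isomorphism D (F0 c) d e)"
    using essentially_surjective[OF d] by blast
  from someI_ex[OF this] have *: "G0 d \<in> obj C \<and> (\<exists>e. isomorphism D (F0 (G0 d)) d e)"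
    unfolding G0_def .
  then show "G0 d \<in> obj C" by blast
  show "isomorphism D (F0 (G0 d)) d (counit d)"
    unfolding counit_def using * by (blast intro: someI_ex)
qed

lemma counit_arr [simp]: "counit d \<in> arr D (F0 (G0 d)) d"
  using counit_iso by (simp add: isomorphism_def)

lemma counit_inv_arr [simp]: "counit_inv d \<in> arr D d (F0 (G0 d))"
  and counit_inv_counit [simp]:
    "cmp D (F0 (G0 d)) d (F0 (G0 d)) (counit_inv d) (counit d) = ident D (F0 (G0 d))"
  and counit_counit_inv [simp]: "cmp D d (F0 (G0 d)) d (counit d) (counit_inv d) = ident D d"
proof -
  have "\<exists>e'. e' \<in> arr D d (F0 (G0 d)) \<and>
     cmp D (F0 (G0 d)) d (F0 (G0 d)) e' (counit d) = ident D (F0 (G0 d)) \<and>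
     cmp D d (F0 (G0 d)) d (counit d) e' = ident D d"
    using counit_iso unfolding isomorphism_def by blast
  from someI_ex[OF this]
  show "counit_inv d \<in> arr D d (F0 (G0 d))"
    "cmp D (F0 (G0 d)) d (F0 (G0 d)) (counit_inv d) (counit d) = ident D (F0 (G0 d))"
    "cmp D d (F0 (G0 d)) d (counit d) (counit_inv d) = ident D d"
    unfolding counit_inv_def by blast+
qed

text \<open>Rewriting with associativity nests composites to the left, so a cancelling pair shows up
  as two successive factors to the right of some \<open>g\<close> and not as a composite of its own.
  This rule removes such a pair.\<close>

lemma cancel_counit [simp]:
  "\<lbrakk>d' \<in> obj D; g \<in> arr D d d'\<rbrakk> \<Longrightarrow>
    cmp D d (F0 (G0 d)) d' (cmp D (F0 (G0 d)) d d' g (counit d)) (counit_inv d) = g"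
  using d by (simp flip: D.cmp_assoc)

end

text \<open>Naturality of \<open>counit\<close> forces \<open>F\<close> of \<open>G h\<close> to be
  this composite.\<close>

definition conjugate :: "'p \<Rightarrow> 'p \<Rightarrow> 'n \<Rightarrow> 'n" where
  "conjugate d d' h = cmp D (F0 (G0 d)) d (F0 (G0 d')) (cmp D d d' (F0 (G0 d')) (counit_inv d') h) (counit d)"

lemma conjugate_arr [simp]:
  "\<lbrakk>d \<in> obj D; d' \<in> obj D; h \<in> arr D d d'\<rbrakk> \<Longrightarrow> conjugate d d' h \<in> arr D (F0 (G0 d)) (F0 (G0 d'))"
  by (simp add: conjugate_def)

definition G :: "('p, 'n, 'o, 'm) functor_data" where
  "G = \<lparr>on_obj = G0, on_arr = (\<lambda>d d' h. F_inv (G0 d') (G0 d) (conjugate d d' h))\<rparr>"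

lemma functor_G: "contravariant_functor D C G"
  unfolding contravariant_functor_def G_def functor_data.simps
proof (intro conjI ballI)
  fix d assume d: "d \<in> obj D"
  show "F_inv (G0 d) (G0 d) (conjugate d d (ident D d)) = ident C (G0 d)"
    by (rule faithful[of "G0 d" "G0 d"]) (use d in \<open>simp_all add: conjugate_def\<close>)
next
  fix d1 d2 d3 f g
  assume *: "d1 \<in> obj D" "d2 \<in> obj D" "d3 \<in> obj D" "f \<in> arr D d1 d2" "g \<in> arr D d2 d3"
  \<comment> \<open>The factors \<open>counit d2\<close> and \<open>counit_inv d2\<close> meet in
    the middle and cancel.\<close>
  have "conjugate d1 d3 (cmp D d1 d2 d3 g f) =
        cmp D (F0 (G0 d1)) (F0 (G0 d2)) (F0 (G0 d3)) (conjugate d2 d3 g) (conjugate d1 d2 f)"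
    unfolding conjugate_def using * by (simp add: D.cmp_assoc)
  then show "F_inv (G0 d3) (G0 d1) (conjugate d1 d3 (cmp D d1 d2 d3 g f)) =
      cmp C (G0 d3) (G0 d2) (G0 d1) (F_inv (G0 d2) (G0 d1) (conjugate d1 d2 f))
        (F_inv (G0 d3) (G0 d2) (conjugate d2 d3 g))"
    by (intro faithful[of "G0 d3" "G0 d1"]) (use * in simp_all)
qed simp_all

lemma natural_FG: "naturally_isomorphic D D (contravariant_composite F G) identity_functor"
proof -
  have "cmp D (F0 (G0 a)) (F0 (G0 b)) b (counit b) (conjugate a b f) = cmp D (F0 (G0 a)) a b f (counit a)"
    if "a \<in> obj D" "b \<in> obj D" "f \<in> arr D a b" for a b f
    unfolding conjugate_def using that by (simp add: D.cmp_assoc)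
  then show ?thesis
    unfolding naturally_isomorphic_def
    by (intro conjI covariant_identity_functor covariant_contravariant_composite[OF functor_G functor_F]
        exI[of _ counit])
      (simp_all add: contravariant_composite_def G_def identity_functor_def counit_iso)
qed

text \<open>Contravariance reverses the arrow: \<open>counit_inv (F0 a)\<close> starts at
  \<open>F0 a\<close>, so its preimage under \<open>F\<close> ends at \<open>a\<close>, as required
  of a transformation from the composite functor to the identity.\<close>

definition unit :: "'o \<Rightarrow> 'm" where
  "unit a = F_inv (G0 (F0 a)) a (counit_inv (F0 a))"

lemma unit_iso:
  assumes a: "a \<in> obj C"
  shows "isomorphism C (G0 (F0 a)) a (unit a)"
proof -
  \<comment> \<open>The inverse of the unit is the preimage of the counit itself.\<close>
  let ?v = "F_inv a (G0 (F0 a)) (counit (F0 a))"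
  have v: "?v \<in> arr C a (G0 (F0 a))" using a by simp
  have "cmp C (G0 (F0 a)) a (G0 (F0 a)) ?v (unit a) = ident C (G0 (F0 a))"
    by (rule faithful[of "G0 (F0 a)" "G0 (F0 a)"]) (use a in \<open>simp_all add: unit_def\<close>)
  moreover have "cmp C a (G0 (F0 a)) a (unit a) ?v = ident C a"
    by (rule faithful[of a a]) (use a in \<open>simp_all add: unit_def\<close>)
  ultimately show ?thesis
    unfolding isomorphism_def using a v by (auto simp: unit_def)
qed

lemma natural_GF: "naturally_isomorphic C C (contravariant_composite G F) identity_functor"
proof -
  have "cmp C (G0 (F0 a)) (G0 (F0 b)) b (unit b)
          (F_inv (G0 (F0 a)) (G0 (F0 b)) (conjugate (F0 b) (F0 a) (F1 a b f))) =
        cmp C (G0 (F0 a)) a b f (unit a)"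
    if "a \<in> obj C" "b \<in> obj C" "f \<in> arr C a b" for a b f
    by (rule faithful[of "G0 (F0 a)" b]) (use that in \<open>simp_all add: unit_def conjugate_def D.cmp_assoc\<close>)
  then show ?thesis
    unfolding naturally_isomorphic_def
    by (intro conjI covariant_identity_functor covariant_contravariant_composite[OF functor_F functor_G]
        exI[of _ unit])
      (simp_all add: contravariant_composite_def G_def identity_functor_def unit_iso)
qed

theorem dually_equivalent: "dually_equivalent C D"
  unfolding dually_equivalent_def
  using C.category_axioms D.category_axioms functor_F functor_G natural_FG natural_GF by blast

end

section \<open>Boolean lattices of sets and Boolean homomorphisms\<close>

text \<open>The map \<open>d\<close> gives the set that an element denotes. Elements are kept apart
  from sets because a clopen algebra must have its carrier in \<open>'u\<close>; for
  \<open>two\<close> the elements are truth values.\<close>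

definition set_lattice :: "'a set \<Rightarrow> ('a \<Rightarrow> 'b set) \<Rightarrow> 'a gorder" where
  "set_lattice S d = \<lparr>carrier = S, eq = (=), le = (\<lambda>a b. d a \<subseteq> d b)\<rparr>"

lemma carrier_set_lattice [simp]: "carrier (set_lattice S d) = S"
  by (simp add: set_lattice_def)

context
  fixes S :: "'a set" and d :: "'a \<Rightarrow> 'b set" and \<Omega> :: "'b set" and M :: "'b set set"
  assumes algebra: "algebra \<Omega> M" and bij: "bij_betw d S M"
begin

interpretation algebra \<Omega> M by (rule algebra)

private abbreviation "L \<equiv> set_lattice S d"

private lemma dS: "a \<in> S \<Longrightarrow> d a \<in> M"
  using bij by (auto simp: bij_betw_def)

private lemma d_eq: "\<lbrakk>a \<in> S; b \<in> S\<rbrakk> \<Longrightarrow> d a = d b \<longleftrightarrow> a = b"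
  using bij by (auto simp: bij_betw_def inj_on_def)

private lemma d_ex: "U \<in> M \<Longrightarrow> \<exists>a \<in> S. d a = U"
  using bij by (auto simp: bij_betw_def)

private lemma partial_order_set_lattice: "Order.partial_order L"
  by unfold_locales (auto simp: set_lattice_def d_eq[symmetric])

text \<open>Some element denotes the union because \<open>M\<close> is closed under unions. It is an
  upper bound, so a least one denotes a subset of the union, and the other inclusion is
  immediate.\<close>

private lemma least_Upper:
  assumes "a \<in> S" "b \<in> S"
  shows "least L c (Upper L {a, b}) \<longleftrightarrow> c \<in> S \<and> d c = d a \<union> d b"
proof -
  obtain e where "e \<in> S" "d e = d a \<union> d b"
    using d_ex[OF Un[OF dS[OF assms(1)] dS[OF assms(2)]]] by blast
  moreover have "Upper L {a, b} = {e \<in> S. d a \<subseteq> d e \<and> d b \<subseteq> d e}"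
    using assms by (auto simp: Upper_def set_lattice_def)
  then have "least L c (Upper L {a, b}) \<longleftrightarrow>
      c \<in> S \<and> d a \<subseteq> d c \<and> d b \<subseteq> d c \<and> (\<forall>e \<in> S. d a \<subseteq> d e \<longrightarrow> d b \<subseteq> d e \<longrightarrow> d c \<subseteq> d e)"
    by (auto simp: least_def set_lattice_def)
  ultimately show ?thesis by (metis Un_least Un_upper1 Un_upper2 subset_antisym)
qed

private lemma greatest_Lower:
  assumes "a \<in> S" "b \<in> S"
  shows "greatest L c (Lower L {a, b}) \<longleftrightarrow> c \<in> S \<and> d c = d a \<inter> d b"
proof -
  obtain e where "e \<in> S" "d e = d a \<inter> d b"
    using d_ex[OF Int[OF dS[OF assms(1)] dS[OF assms(2)]]] by blast
  moreover have "Lower L {a, b} = {e \<in> S. d e \<subseteq> d a \<and> d e \<subseteq> d b}"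
    using assms by (auto simp: Lower_def set_lattice_def)
  then have "greatest L c (Lower L {a, b}) \<longleftrightarrow>
      c \<in> S \<and> d c \<subseteq> d a \<and> d c \<subseteq> d b \<and> (\<forall>e \<in> S. d e \<subseteq> d a \<longrightarrow> d e \<subseteq> d b \<longrightarrow> d e \<subseteq> d c)"
    by (auto simp: greatest_def set_lattice_def)
  ultimately show ?thesis by (metis Int_greatest Int_lower1 Int_lower2 subset_antisym)
qed

private lemma least_bottom: "least L c S \<longleftrightarrow> c \<in> S \<and> d c = {}"
  using d_ex[OF empty_sets] by (fastforce simp: least_def set_lattice_def)

private lemma greatest_top: "greatest L c S \<longleftrightarrow> c \<in> S \<and> d c = \<Omega>"
  using d_ex[OF top] dS space_closed by (fastforce simp: greatest_def set_lattice_def)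

private lemma bounded_set_lattice: "Lattice.bounded_lattice L"
proof -
  interpret Order.partial_order L by (rule partial_order_set_lattice)
  show ?thesis
  proof
    show "\<exists>s. least L s (Upper L {x, y})" if "x \<in> carrier L" "y \<in> carrier L" for x y
      using that least_Upper d_ex[OF Un[OF dS[of x] dS[of y]]] by auto
    show "\<exists>s. greatest L s (Lower L {x, y})" if "x \<in> carrier L" "y \<in> carrier L" for x y
      using that greatest_Lower d_ex[OF Int[OF dS[of x] dS[of y]]] by auto
    show "\<exists>x. least L x (carrier L)"
      using least_bottom d_ex[OF empty_sets] by auto
    show "\<exists>x. greatest L x (carrier L)"
      using greatest_top d_ex[OF top] by auto
  qed
qed

interpretation L: Lattice.bounded_lattice L by (rule bounded_set_lattice)

lemma set_lattice_join: "\<lbrakk>a \<in> S; b \<in> S\<rbrakk> \<Longrightarrow> d (a \<squnion>\<^bsub>set_lattice S d\<^esub> b) = d a \<union> d b"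
  by (rule L.joinI) (auto simp: least_Upper)

lemma set_lattice_meet: "\<lbrakk>a \<in> S; b \<in> S\<rbrakk> \<Longrightarrow> d (a \<sqinter>\<^bsub>set_lattice S d\<^esub> b) = d a \<inter> d b"
  by (rule L.meetI) (auto simp: greatest_Lower)

lemma set_lattice_bottom: "d \<bottom>\<^bsub>set_lattice S d\<^esub> = {}"
  using L.bottom_least by (simp add: least_bottom)

lemma set_lattice_top: "d \<top>\<^bsub>set_lattice S d\<^esub> = \<Omega>"
  using L.top_greatest by (simp add: greatest_top)

lemma boolean_set_lattice: "boolean_lattice (set_lattice S d)"
proof
  note [simp] = set_lattice_join set_lattice_meet set_lattice_bottom set_lattice_top
  have closed [simp]: "a \<squnion>\<^bsub>L\<^esub> b \<in> S" "a \<sqinter>\<^bsub>L\<^esub> b \<in> S" "\<top>\<^bsub>L\<^esub> \<in> S" "\<bottom>\<^bsub>L\<^esub> \<in> S"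
    if "a \<in> S" "b \<in> S" for a b
    using L.join_closed[of a b] L.meet_closed[of a b] L.top_closed L.bottom_closed that by auto
  \<comment> \<open>Since \<open>d\<close> is injective, the law may be checked on the denoted
    sets.\<close>
  show "x \<sqinter>\<^bsub>L\<^esub> (y \<squnion>\<^bsub>L\<^esub> z) = x \<sqinter>\<^bsub>L\<^esub> y \<squnion>\<^bsub>L\<^esub> x \<sqinter>\<^bsub>L\<^esub> z"
    if "x \<in> carrier L" "y \<in> carrier L" "z \<in> carrier L" for x y z
    using that by (subst d_eq[symmetric]) auto
  show "\<exists>y\<in>carrier L. x \<squnion>\<^bsub>L\<^esub> y = \<top>\<^bsub>L\<^esub> \<and> x \<sqinter>\<^bsub>L\<^esub> y = \<bottom>\<^bsub>L\<^esub>" if x: "x \<in> carrier L" for x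
  proof -
    obtain y where y: "y \<in> S" "d y = \<Omega> - d x"
      using d_ex[OF compl_sets[OF dS]] x by auto
    moreover have "d x \<subseteq> \<Omega>" using dS x space_closed by auto
    ultimately have "d (x \<squnion>\<^bsub>L\<^esub> y) = d \<top>\<^bsub>L\<^esub>" "d (x \<sqinter>\<^bsub>L\<^esub> y) = d \<bottom>\<^bsub>L\<^esub>"
      using x by auto
    then show ?thesis
      using x y by (intro bexI[of _ y] conjI d_eq[THEN iffD1]) auto
  qed
qed

end

section \<open>Boolean homomorphisms and the two-element algebra\<close>

lemma boolean_homI:
  assumes "Lattice.lattice A" "Lattice.lattice B" "\<phi> \<in> extensional (carrier A)"
    and "\<And>a. a \<in> carrier A \<Longrightarrow> \<phi> a \<in> carrier B"
    and "\<And>a b. \<lbrakk>a \<in> carrier A; b \<in> carrier A\<rbrakk> \<Longrightarrow> \<phi> (a \<squnion>\<^bsub>A\<^esub> b) = \<phi> a \<squnion>\<^bsub>B\<^esub> \<phi> b"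
    and "\<And>a b. \<lbrakk>a \<in> carrier A; b \<in> carrier A\<rbrakk> \<Longrightarrow> \<phi> (a \<sqinter>\<^bsub>A\<^esub> b) = \<phi> a \<sqinter>\<^bsub>B\<^esub> \<phi> b"
    and "\<phi> \<bottom>\<^bsub>A\<^esub> = \<bottom>\<^bsub>B\<^esub>" "\<phi> \<top>\<^bsub>A\<^esub> = \<top>\<^bsub>B\<^esub>"
  shows "\<phi> \<in> boolean_hom A B"
  using assms by (simp add: boolean_hom_def join_pres_def meet_pres_def PiE_iff)

lemma boolean_homD:
  assumes "\<phi> \<in> boolean_hom A B"
  shows "Lattice.lattice A" "Lattice.lattice B" "\<phi> \<in> extensional (carrier A)"
    and "\<And>a. a \<in> carrier A \<Longrightarrow> \<phi> a \<in> carrier B"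
    and "\<And>a b. \<lbrakk>a \<in> carrier A; b \<in> carrier A\<rbrakk> \<Longrightarrow> \<phi> (a \<squnion>\<^bsub>A\<^esub> b) = \<phi> a \<squnion>\<^bsub>B\<^esub> \<phi> b"
    and "\<And>a b. \<lbrakk>a \<in> carrier A; b \<in> carrier A\<rbrakk> \<Longrightarrow> \<phi> (a \<sqinter>\<^bsub>A\<^esub> b) = \<phi> a \<sqinter>\<^bsub>B\<^esub> \<phi> b"
    and "\<phi> \<bottom>\<^bsub>A\<^esub> = \<bottom>\<^bsub>B\<^esub>" "\<phi> \<top>\<^bsub>A\<^esub> = \<top>\<^bsub>B\<^esub>"
  using assms by (auto simp: boolean_hom_def join_pres_def meet_pres_def PiE_iff)

lemma boolean_lattice_imp_lattice: "boolean_lattice A \<Longrightarrow> Lattice.lattice A"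
  by (simp add: boolean_lattice_def Lattice.bounded_lattice_def)

lemma boolean_lattice_closed:
  assumes "boolean_lattice A"
  shows "\<bottom>\<^bsub>A\<^esub> \<in> carrier A" "\<top>\<^bsub>A\<^esub> \<in> carrier A"
    and "\<lbrakk>a \<in> carrier A; b \<in> carrier A\<rbrakk> \<Longrightarrow> a \<squnion>\<^bsub>A\<^esub> b \<in> carrier A"
    and "\<lbrakk>a \<in> carrier A; b \<in> carrier A\<rbrakk> \<Longrightarrow> a \<sqinter>\<^bsub>A\<^esub> b \<in> carrier A"
proof -
  interpret boolean_lattice A by fact
  show "\<bottom>\<^bsub>A\<^esub> \<in> carrier A" "\<top>\<^bsub>A\<^esub> \<in> carrier A"
    "\<lbrakk>a \<in> carrier A; b \<in> carrier A\<rbrakk> \<Longrightarrow> a \<squnion>\<^bsub>A\<^esub> b \<in> carrier A"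
    "\<lbrakk>a \<in> carrier A; b \<in> carrier A\<rbrakk> \<Longrightarrow> a \<sqinter>\<^bsub>A\<^esub> b \<in> carrier A"
    by simp_all
qed

lemma boolean_hom_id:
  assumes "boolean_lattice A"
  shows "(\<lambda>a \<in> carrier A. a) \<in> boolean_hom A A"
  by (intro boolean_homI boolean_lattice_imp_lattice assms)
    (simp_all add: assms boolean_lattice_closed)

lemma boolean_hom_compose:
  assumes "boolean_lattice A" "\<phi> \<in> boolean_hom A B" "\<psi> \<in> boolean_hom B C"
  shows "compose (carrier A) \<psi> \<phi> \<in> boolean_hom A C"
  by (rule boolean_homI)
    (use assms in \<open>auto simp: compose_eq boolean_lattice_closed boolean_homD\<close>)

lemma boolean_hom_inv_into:
  assumes A: "boolean_lattice A" and B: "boolean_lattice B" and \<phi>: "\<phi> \<in> boolean_hom A B"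
    and bij: "bij_betw \<phi> (carrier A) (carrier B)"
  shows "restrict (inv_into (carrier A) \<phi>) (carrier B) \<in> boolean_hom B A"
proof -
  let ?\<psi> = "inv_into (carrier A) \<phi>"
  have inj: "inj_on \<phi> (carrier A)" and surj: "\<phi> ` carrier A = carrier B"
    using bij by (auto simp: bij_betw_def)
  have \<psi>: "?\<psi> b \<in> carrier A" "\<phi> (?\<psi> b) = b" if "b \<in> carrier B" for b
    using that surj by (auto intro: inv_into_into f_inv_into_f)
  \<comment> \<open>To evaluate the inverse at \<open>b\<close> it suffices to name an element that
    \<open>\<phi>\<close> sends to \<open>b\<close>; each homomorphism law of \<open>\<phi>\<close>
    supplies one.\<close>
  have eq: "?\<psi> b = a" if "a \<in> carrier A" "\<phi> a = b" for a b
    using inv_into_f_f[OF inj] that by blast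
  show ?thesis
    by (rule boolean_homI)
      (simp_all add: assms boolean_lattice_imp_lattice boolean_lattice_closed \<psi> eq boolean_homD[OF \<phi>])
qed

text \<open>Truth values denote subsets of a one-point set, so \<open>two\<close> is a power set
  lattice and inherits its operations from \<open>set_lattice\<close>.\<close>

lemma two_eq_set_lattice: "two = set_lattice UNIV (\<lambda>b. {u::unit. b})"
  by (auto simp: two_def set_lattice_def fun_eq_iff)

lemma bij_betw_two: "bij_betw (\<lambda>b. {u::unit. b}) UNIV (Pow UNIV)"
proof -
  have "U \<in> range (\<lambda>b. {u::unit. b})" for U :: "unit set"
    by (rule range_eqI[of _ _ "() \<in> U"]) auto
  then show ?thesis by (auto simp: bij_betw_def inj_on_def)
qed

lemma boolean_two: "boolean_lattice two"
  unfolding two_eq_set_lattice by (rule boolean_set_lattice[OF algebra_Pow bij_betw_two])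

lemma two_simps [simp]:
  "carrier two = UNIV" "a \<squnion>\<^bsub>two\<^esub> b \<longleftrightarrow> a \<or> b" "a \<sqinter>\<^bsub>two\<^esub> b \<longleftrightarrow> a \<and> b"
  "\<bottom>\<^bsub>two\<^esub> = False" "\<top>\<^bsub>two\<^esub> = True"
proof -
  note two = two_eq_set_lattice[symmetric]
  show "carrier two = UNIV" by (simp add: two_def)
  show "a \<squnion>\<^bsub>two\<^esub> b \<longleftrightarrow> a \<or> b"
    using set_lattice_join[OF algebra_Pow bij_betw_two, of a b, unfolded two] by blast
  show "a \<sqinter>\<^bsub>two\<^esub> b \<longleftrightarrow> a \<and> b"
    using set_lattice_meet[OF algebra_Pow bij_betw_two, of a b, unfolded two] by blast
  show "\<bottom>\<^bsub>two\<^esub> = False"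
    using set_lattice_bottom[OF algebra_Pow bij_betw_two, unfolded two] by blast
  show "\<top>\<^bsub>two\<^esub> = True"
    using set_lattice_top[OF algebra_Pow bij_betw_two, unfolded two] by blast
qed

text \<open>The laws are spelled out so that their negation enumerates the ways in which a function
  can fail to be a homomorphism.\<close>

lemma boolean_hom_two_iff:
  assumes "Lattice.lattice A"
  shows "p \<in> boolean_hom A two \<longleftrightarrow> p \<in> extensional (carrier A) \<and>
    (\<forall>a \<in> carrier A. \<forall>b \<in> carrier A. p (a \<squnion>\<^bsub>A\<^esub> b) = (p a \<or> p b)) \<and>
    (\<forall>a \<in> carrier A. \<forall>b \<in> carrier A. p (a \<sqinter>\<^bsub>A\<^esub> b) = (p a \<and> p b)) \<and>
    \<not> p \<bottom>\<^bsub>A\<^esub> \<and> p \<top>\<^bsub>A\<^esub>"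
  using assms boolean_lattice_imp_lattice[OF boolean_two]
  by (auto simp: boolean_hom_def join_pres_def meet_pres_def PiE_iff)

text \<open>If \<open>x\<close> is not below \<open>y\<close>, the meet of \<open>x\<close> with a
  complement of \<open>y\<close> is nonzero, and a member of \<open>P\<close> true there is true at
  \<open>x\<close> and false at \<open>y\<close>. Applied in both directions, this gives
  equality.\<close>

lemma boolean_lattice_separation:
  assumes A: "boolean_lattice A" and P: "P \<subseteq> boolean_hom A two"
    and nz: "\<And>a. \<lbrakk>a \<in> carrier A; a \<noteq> \<bottom>\<^bsub>A\<^esub>\<rbrakk> \<Longrightarrow> \<exists>p \<in> P. p a"
    and ab: "a \<in> carrier A" "b \<in> carrier A" and eq: "\<And>p. p \<in> P \<Longrightarrow> p a = p b"
  shows "a = b"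
proof -
  interpret boolean_lattice A by (rule A)
  have le: "x \<sqsubseteq>\<^bsub>A\<^esub> y" if xy: "x \<in> carrier A" "y \<in> carrier A" "\<And>p. p \<in> P \<Longrightarrow> p x \<Longrightarrow> p y" for x y
  proof -
    obtain z where z: "z \<in> carrier A" "y \<squnion>\<^bsub>A\<^esub> z = \<top>\<^bsub>A\<^esub>" "y \<sqinter>\<^bsub>A\<^esub> z = \<bottom>\<^bsub>A\<^esub>"
      using complemented xy by blast
    have "\<not> p (x \<sqinter>\<^bsub>A\<^esub> z)" if p: "p \<in> P" for p
    proof -
      have h: "p \<in> boolean_hom A two" using p P by blast
      have "p y \<and> p z \<longleftrightarrow> False"
        using boolean_homD(6)[OF h, of y z] boolean_homD(7)[OF h] z xy by simp
      then show ?thesis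
        using boolean_homD(6)[OF h, of x z] z xy p by auto
    qed
    then have "x \<sqinter>\<^bsub>A\<^esub> z = \<bottom>\<^bsub>A\<^esub>" using nz[of "x \<sqinter>\<^bsub>A\<^esub> z"] xy z by auto
    \<comment> \<open>Distributing \<open>x\<close> over the join of \<open>y\<close> and its
      complement \<open>z\<close>, and dropping the zero summand, leaves the meet of
      \<open>x\<close> and \<open>y\<close>.\<close>
    moreover have "x = x \<sqinter>\<^bsub>A\<^esub> \<top>\<^bsub>A\<^esub>"
      using xy by (simp flip: le_iff_join)
    ultimately have "x = (x \<sqinter>\<^bsub>A\<^esub> y) \<squnion>\<^bsub>A\<^esub> \<bottom>\<^bsub>A\<^esub>"
      using distrib[of x y z] xy z by simp
    also have "\<dots> = x \<sqinter>\<^bsub>A\<^esub> y"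
      using bottom_join[of "x \<sqinter>\<^bsub>A\<^esub> y"] xy by (simp add: join_comm eq_is_equal)
    finally show ?thesis using xy by (simp add: le_iff_join)
  qed
  show ?thesis by (rule le_antisym) (use le ab eq in auto)
qed

section \<open>The category of Boolean z-algebras\<close>

lemma obj_zBoole:
  "(A, X) \<in> obj zBoole \<longleftrightarrow> small (carrier A) \<and> boolean_lattice A \<and> X \<subseteq> boolean_hom A two \<and>
     (\<forall>a \<in> carrier A. a \<noteq> \<bottom>\<^bsub>A\<^esub> \<longrightarrow> (\<exists>x \<in> X. x a))"
  by (auto simp: zBoole_def boolean_zalgebra_def)

lemma arr_zBoole:
  "(\<phi>, f) \<in> arr zBoole (A, X) (A', X') \<longleftrightarrow>
     \<phi> \<in> boolean_hom A A' \<and> f \<in> X' \<rightarrow>\<^sub>E X \<and> (\<forall>x' \<in> X'. compose (carrier A) x' \<phi> = f x')"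
  by (simp add: zBoole_def)

lemma cmp_zBoole:
  "cmp zBoole (A, X) B (A'', X'') (\<phi>', f') (\<phi>, f) =
     (compose (carrier A) \<phi>' \<phi>, compose X'' f f')"
  by (simp add: zBoole_def)

lemma ident_zBoole: "ident zBoole (A, X) = (\<lambda>a \<in> carrier A. a, \<lambda>x \<in> X. x)"
  by (simp add: zBoole_def)

lemmas zBoole_simps = obj_zBoole arr_zBoole cmp_zBoole ident_zBoole

text \<open>The action of an arrow on distinguished homomorphisms is precomposition, so its algebra
  homomorphism determines it. Equalities of arrows can thus be settled on first components.\<close>

lemma zBoole_arr_eqI:
  assumes "(\<phi>, f) \<in> arr zBoole (A, X) (A', X')" "(\<phi>, g) \<in> arr zBoole (A, X) (A', X')"
  shows "f = g"
  using assms by (auto simp: arr_zBoole intro!: PiE_ext[of f X' "\<lambda>_. X" g])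

lemma compose_restrict_id: "f \<in> extensional S \<Longrightarrow> compose S f (\<lambda>x \<in> S. x) = f"
  by (rule extensionalityI[of _ S]) (simp_all add: compose_eq)

lemma compose_id_restrict:
  "\<lbrakk>f \<in> extensional S; f \<in> S \<rightarrow> T\<rbrakk> \<Longrightarrow> compose S (\<lambda>x \<in> T. x) f = f"
  by (rule extensionalityI[of _ S]) (auto simp: compose_eq)

lemma compose_eq_id: "(\<And>x. x \<in> S \<Longrightarrow> g (f x) = x) \<Longrightarrow> compose S g f = (\<lambda>x \<in> S. x)"
  by (auto simp: compose_def)

lemma category_zBoole: "category zBoole"
proof
  fix a :: "'u zalgebra" assume a: "a \<in> obj zBoole"
  obtain A X where [simp]: "a = (A, X)" by force
  show "ident zBoole a \<in> arr zBoole a a"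
    using a by (auto simp: zBoole_simps boolean_hom_id compose_restrict_id boolean_homD(3) subset_iff)
next
  fix a b c :: "'u zalgebra" and f g
  assume *: "a \<in> obj zBoole" "b \<in> obj zBoole" "c \<in> obj zBoole" "f \<in> arr zBoole a b" "g \<in> arr zBoole b c"
  obtain A X B Y C Z where [simp]: "a = (A, X)" "b = (B, Y)" "c = (C, Z)" by (meson surj_pair)
  obtain \<phi> p \<psi> q where [simp]: "f = (\<phi>, p)" "g = (\<psi>, q)" by (meson surj_pair)
  have \<phi>: "\<phi> \<in> boolean_hom A B" and \<psi>: "\<psi> \<in> boolean_hom B C" 
    and p: "p \<in> Y \<rightarrow>\<^sub>E X" "\<And>y. y \<in> Y \<Longrightarrow> compose (carrier A) y \<phi> = p y"
    and q: "q \<in> Z \<rightarrow>\<^sub>E Y" "\<And>z. z \<in> Z \<Longrightarrow> compose (carrier B) z \<psi> = q z"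
    using * by (auto simp: zBoole_simps)
  have "compose (carrier A) z (compose (carrier A) \<psi> \<phi>) = p (q z)" if z: "z \<in> Z" for z
  proof -
    \<comment> \<open>The inner restriction does no harm because \<open>\<phi>\<close> takes its
      values in the carrier of \<open>B\<close>.\<close>
    have "compose (carrier A) z (compose (carrier A) \<psi> \<phi>) = compose (carrier A) (compose (carrier B) z \<psi>) \<phi>"
      using boolean_homD(4)[OF \<phi>] by (auto simp: compose_def)
    then show ?thesis using p q z by auto
  qed
  then show "cmp zBoole a b c g f \<in> arr zBoole a c"
    using * \<phi> \<psi> p(1) q(1) by (auto simp: zBoole_simps boolean_hom_compose compose_eq PiE_iff)
next
  fix a b :: "'u zalgebra" and f
  assume *: "a \<in> obj zBoole" "b \<in> obj zBoole" "f \<in> arr zBoole a b"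
  obtain A X B Y \<phi> p where [simp]: "a = (A, X)" "b = (B, Y)" "f = (\<phi>, p)" by (meson surj_pair)
  have "\<phi> \<in> boolean_hom A B" "p \<in> Y \<rightarrow>\<^sub>E X" using * by (auto simp: zBoole_simps)
  then show "cmp zBoole a a b f (ident zBoole a) = f" "cmp zBoole a b b (ident zBoole b) f = f"
    by (auto simp: zBoole_simps boolean_homD PiE_iff compose_restrict_id compose_id_restrict)
next
  fix a b c d :: "'u zalgebra" and f g h
  assume *: "a \<in> obj zBoole" "b \<in> obj zBoole" "c \<in> obj zBoole" "d \<in> obj zBoole"
    "f \<in> arr zBoole a b" "g \<in> arr zBoole b c" "h \<in> arr zBoole c d"
  obtain A X B Y C Z D W where [simp]: "a = (A, X)" "b = (B, Y)" "c = (C, Z)" "d = (D, W)"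
    by (meson surj_pair)
  obtain \<phi> p \<psi> q \<xi> r where [simp]: "f = (\<phi>, p)" "g = (\<psi>, q)" "h = (\<xi>, r)" by (meson surj_pair)
  have "\<phi> \<in> carrier A \<rightarrow> carrier B" "r \<in> W \<rightarrow> Z"
    using * by (auto simp: zBoole_simps boolean_homD)
  then show "cmp zBoole a c d h (cmp zBoole a b c g f) = cmp zBoole a b d (cmp zBoole b c d h g) f"
    by (simp add: zBoole_simps compose_assoc)
qed

text \<open>The isomorphism runs against \<open>\<phi>\<close>, the direction asked for by essential
  surjectivity. Precomposition with \<open>\<phi>\<close> maps \<open>Y\<close> onto
  \<open>X\<close> by hypothesis, and it is injective because precomposition with the inverse undoes
  it.\<close>

lemma isomorphism_zBoole:
  assumes a: "(A, X) \<in> obj zBoole" and b: "(B, Y) \<in> obj zBoole"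
    and \<phi>: "\<phi> \<in> boolean_hom A B" "bij_betw \<phi> (carrier A) (carrier B)"
    and X: "(\<lambda>y. compose (carrier A) y \<phi>) ` Y = X"
  shows "\<exists>e. isomorphism zBoole (B, Y) (A, X) e"
proof -
  let ?\<psi> = "restrict (inv_into (carrier A) \<phi>) (carrier B)"
  let ?f = "\<lambda>y \<in> Y. compose (carrier A) y \<phi>" and ?g = "\<lambda>x \<in> X. compose (carrier B) x ?\<psi>"
  have \<psi>: "?\<psi> \<in> boolean_hom B A"
    using boolean_hom_inv_into[OF _ _ \<phi>] a b by (simp add: obj_zBoole)
  have \<psi>\<phi>: "compose (carrier A) ?\<psi> \<phi> = (\<lambda>a \<in> carrier A. a)"
    and \<phi>\<psi>: "compose (carrier B) \<phi> ?\<psi> = (\<lambda>b \<in> carrier B. b)"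
    using compose_inv_into_id[OF \<phi>(2)] compose_id_inv_into[OF \<phi>(2)[THEN bij_betw_imp_surj_on]] .
  have ext: "y \<in> extensional (carrier B)" if "y \<in> Y" for y
    using that b boolean_homD(3)[of y B two] by (auto simp: obj_zBoole)
  have y: "compose (carrier B) (compose (carrier A) y \<phi>) ?\<psi> = y" if "y \<in> Y" for y
  proof -
    have "compose (carrier B) (compose (carrier A) y \<phi>) ?\<psi> = compose (carrier B) y (compose (carrier B) \<phi> ?\<psi>)"
      using boolean_homD(4)[OF \<psi>] by (auto simp: compose_def)
    then show ?thesis using compose_restrict_id[OF ext[OF that]] by (simp add: \<phi>\<psi>)
  qed
  have f: "(\<phi>, ?f) \<in> arr zBoole (A, X) (B, Y)"
    using \<phi> X by (auto simp: arr_zBoole)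
  have g: "(?\<psi>, ?g) \<in> arr zBoole (B, Y) (A, X)"
    using \<psi> X y by (auto simp: arr_zBoole)
  have gf: "?g (?f y) = y" "?f y \<in> X" if "y \<in> Y" for y
    using that X y[OF that] by auto
  then have fg: "?f (?g x) = x" "?g x \<in> Y" if "x \<in> X" for x
    using that X by auto
  have "compose X ?f ?g = (\<lambda>x \<in> X. x)" "compose Y ?g ?f = (\<lambda>y \<in> Y. y)"
    by (rule compose_eq_id, erule fg gf)+
  then have "isomorphism zBoole (B, Y) (A, X) (?\<psi>, ?g)"
    unfolding isomorphism_def
    by (intro conjI bexI[OF _ f] g) (simp_all add: cmp_zBoole ident_zBoole \<psi>\<phi> \<phi>\<psi>)
  then show ?thesis ..
qed

section \<open>Clopen sets of compact spaces\<close>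

definition clopens :: "'a topology \<Rightarrow> 'a set set" where
  "clopens Y = {U. openin Y U \<and> closedin Y U}"

lemma clopensD: "U \<in> clopens Y \<Longrightarrow> openin Y U" "U \<in> clopens Y \<Longrightarrow> closedin Y U"
  "U \<in> clopens Y \<Longrightarrow> U \<subseteq> topspace Y"
  by (auto simp: clopens_def openin_subset)

lemma algebra_clopens: "algebra (topspace Y) (clopens Y)"
  unfolding algebra_iff_Int by (auto simp: clopens_def dest: openin_subset)

text \<open>Any clopen base may be enlarged to the set of all clopen sets, which removes the choice
  of a base.\<close>

lemma zero_dimensional_iff:
  "zero_dimensional Y \<longleftrightarrow> (\<forall>U y. openin Y U \<longrightarrow> y \<in> U \<longrightarrow> (\<exists>V \<in> clopens Y. y \<in> V \<and> V \<subseteq> U))"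
  (is "_ \<longleftrightarrow> ?R")
proof
  assume "zero_dimensional Y"
  then show ?R
    unfolding zero_dimensional_def openin_topology_base_unique clopens_def by blast
next
  assume ?R
  then have "openin Y = arbitrary union_of (\<lambda>U. U \<in> clopens Y)"
    unfolding openin_topology_base_unique by (auto simp: clopens_def)
  then show "zero_dimensional Y"
    unfolding zero_dimensional_def by (intro exI[of _ "clopens Y"]) (auto simp: clopens_def)
qed

lemma zero_dimensional_separation:
  assumes "zero_dimensional Y" "Hausdorff_space Y" "x \<in> topspace Y" "y \<in> topspace Y" "x \<noteq> y"
  shows "\<exists>U \<in> clopens Y. x \<in> U \<and> y \<notin> U"
proof -
  obtain U V where UV: "openin Y U" "x \<in> U" "y \<in> V" "disjnt U V"
    using assms unfolding Hausdorff_space_def by metis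
  obtain W where "W \<in> clopens Y" "x \<in> W" "W \<subseteq> U"
    using assms(1) UV(1,2) unfolding zero_dimensional_iff by blast
  then show ?thesis using UV(3,4) by (auto simp: disjnt_iff)
qed

text \<open>Compactness is used twice. For a point of \<open>K\<close>, finitely many members of
  \<open>M\<close> missing it cover \<open>L\<close>, and the complement of their union is a
  neighbourhood in \<open>M\<close>; finitely many such neighbourhoods cover
  \<open>K\<close>.\<close>

lemma compact_separation:
  assumes Y: "compact_space Y" and M: "algebra (topspace Y) M"
    and open_M: "\<And>U. U \<in> M \<Longrightarrow> openin Y U"
    and sep: "\<And>x y. \<lbrakk>x \<in> topspace Y; y \<in> topspace Y; x \<noteq> y\<rbrakk> \<Longrightarrow> \<exists>U \<in> M. x \<in> U \<and> y \<notin> U"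
    and K: "closedin Y K" and L: "closedin Y L" and KL: "K \<inter> L = {}"
  shows "\<exists>U \<in> M. K \<subseteq> U \<and> U \<inter> L = {}"
proof -
  interpret algebra "topspace Y" M by (rule M)
  have *: "\<exists>U \<in> M. x \<in> U \<and> U \<inter> L = {}" if x: "x \<in> K" for x
  proof -
    have "L \<subseteq> \<Union>{U \<in> M. x \<notin> U}"
    proof
      fix y assume "y \<in> L"
      then have "y \<in> topspace Y" "x \<in> topspace Y" "y \<noteq> x"
        using x KL closedin_subset[OF K] closedin_subset[OF L] by auto
      then show "y \<in> \<Union>{U \<in> M. x \<notin> U}" using sep[of y x] by blast
    qed
    then obtain F where F: "finite F" "F \<subseteq> {U \<in> M. x \<notin> U}" "L \<subseteq> \<Union>F"
      using compactinD[OF closedin_compact_space[OF Y L], of "{U \<in> M. x \<notin> U}"] open_M by auto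
    then have "topspace Y - \<Union>F \<in> M"
      by (intro compl_sets finite_Union) auto
    then show ?thesis
      using F x closedin_subset[OF K] by (intro bexI[of _ "topspace Y - \<Union>F"]) auto
  qed
  then have "K \<subseteq> \<Union>{U \<in> M. U \<inter> L = {}}" by blast
  then obtain F where F: "finite F" "F \<subseteq> {U \<in> M. U \<inter> L = {}}" "K \<subseteq> \<Union>F"
    using compactinD[OF closedin_compact_space[OF Y K], of "{U \<in> M. U \<inter> L = {}}"] open_M by auto
  then show ?thesis by (intro bexI[of _ "\<Union>F"] finite_Union) auto
qed

text \<open>A clopen set and its complement are disjoint closed sets, so a member of
  \<open>M\<close> separates them and must equal the clopen set. For Stone spaces this means that no
  clopen sets arise beyond those given by elements of the algebra.\<close>

lemma compact_separating_algebra: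
  assumes Y: "compact_space Y" and M: "algebra (topspace Y) M"
    and open_M: "\<And>U. U \<in> M \<Longrightarrow> openin Y U"
    and sep: "\<And>x y. \<lbrakk>x \<in> topspace Y; y \<in> topspace Y; x \<noteq> y\<rbrakk> \<Longrightarrow> \<exists>U \<in> M. x \<in> U \<and> y \<notin> U"
  shows "clopens Y = M" "Hausdorff_space Y" "zero_dimensional Y"
proof -
  interpret algebra "topspace Y" M by (rule M)
  have clopen: "U \<in> clopens Y" if "U \<in> M" for U
    using open_M[OF that] open_M[OF compl_sets[OF that]] sets_into_space[OF that]
    by (simp add: clopens_def closedin_def)
  have "U \<in> M" if U: "U \<in> clopens Y" for U
  proof -
    have "closedin Y (topspace Y - U)" "U \<subseteq> topspace Y"
      using U by (auto dest: clopensD)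
    then obtain V where "V \<in> M" "U \<subseteq> V" "V \<inter> (topspace Y - U) = {}"
      using compact_separation[OF Y M open_M sep clopensD(2)[OF U], of "topspace Y - U"] by auto
    moreover have "V \<subseteq> topspace Y" using \<open>V \<in> M\<close> sets_into_space by auto
    ultimately show ?thesis by (metis Diff_eq_empty_iff Int_Diff inf.absorb1 subset_antisym)
  qed
  with clopen show "clopens Y = M" by blast
  show H: "Hausdorff_space Y"
    unfolding Hausdorff_space_def
  proof (intro allI impI)
    fix x y assume xy: "x \<in> topspace Y \<and> y \<in> topspace Y \<and> x \<noteq> y"
    then obtain U where U: "U \<in> M" "x \<in> U" "y \<notin> U" using sep[of x y] by blast
    then show "\<exists>U V. openin Y U \<and> openin Y V \<and> x \<in> U \<and> y \<in> V \<and> disjnt U V"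
      using xy open_M[OF U(1)] open_M[OF compl_sets[OF U(1)]]
      by (intro exI[of _ U] exI[of _ "topspace Y - U"]) (auto simp: disjnt_def)
  qed
  show "zero_dimensional Y"
    unfolding zero_dimensional_iff
  proof (intro allI impI)
    fix U y assume U: "openin Y U" "y \<in> U"
    then have y: "y \<in> topspace Y" using openin_subset by blast
    \<comment> \<open>Separating \<open>y\<close> from the complement of \<open>U\<close> yields a
      member of \<open>M\<close> that lies inside \<open>U\<close>.\<close>
    have "closedin Y {y}" "closedin Y (topspace Y - U)"
      using U y H by (auto simp: closedin_Hausdorff_singleton)
    then obtain V where V: "V \<in> M" "y \<in> V" "V \<inter> (topspace Y - U) = {}"
      using compact_separation[OF Y M open_M sep, of "{y}" "topspace Y - U"] U by auto
    then show "\<exists>V \<in> clopens Y. y \<in> V \<and> V \<subseteq> U"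
      using clopen[OF V(1)] sets_into_space[OF V(1)] by (intro bexI[of _ V]) auto
  qed
qed

lemma continuous_map_clopenI:
  assumes "zero_dimensional Y'" "\<And>y. y \<in> topspace Y \<Longrightarrow> g y \<in> topspace Y'"
    and "\<And>U. U \<in> clopens Y' \<Longrightarrow> openin Y {y \<in> topspace Y. g y \<in> U}"
  shows "continuous_map Y Y' g"
  unfolding continuous_map
proof (intro conjI allI impI)
  show "g ` topspace Y \<subseteq> topspace Y'" using assms(2) by auto
  fix W assume W: "openin Y' W"
  show "openin Y {y \<in> topspace Y. g y \<in> W}"
  proof (subst openin_subopen, intro ballI)
    fix y assume y: "y \<in> {y \<in> topspace Y. g y \<in> W}"
    then obtain U where "U \<in> clopens Y'" "g y \<in> U" "U \<subseteq> W"
      using assms(1) W unfolding zero_dimensional_iff by blast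
    then show "\<exists>T. openin Y T \<and> y \<in> T \<and> T \<subseteq> {y \<in> topspace Y. g y \<in> W}"
      using y assms(3)[of U] by (intro exI[of _ "{y \<in> topspace Y. g y \<in> U}"]) auto
  qed
qed

text \<open>The clopen sets satisfying \<open>p\<close> form a prime filter. By compactness they
  have a common point \<open>y\<close>. If \<open>y\<close> lies in \<open>U\<close>, the complement
  of \<open>U\<close> cannot satisfy \<open>p\<close>, so primality gives
  \<open>p U\<close>.\<close>

lemma clopen_prime_filter_point:
  assumes Y: "compact_space Y"
    and p_Int: "\<And>U V. \<lbrakk>U \<in> clopens Y; V \<in> clopens Y\<rbrakk> \<Longrightarrow> p (U \<inter> V) \<longleftrightarrow> p U \<and> p V"
    and p_Un: "\<And>U V. \<lbrakk>U \<in> clopens Y; V \<in> clopens Y\<rbrakk> \<Longrightarrow> p (U \<union> V) \<longleftrightarrow> p U \<or> p V"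
    and p_empty: "\<not> p {}" and p_top: "p (topspace Y)"
  shows "\<exists>y \<in> topspace Y. \<forall>U \<in> clopens Y. p U \<longleftrightarrow> y \<in> U"
proof -
  interpret algebra "topspace Y" "clopens Y" by (rule algebra_clopens)
  let ?F = "{U \<in> clopens Y. p U}"
  \<comment> \<open>The intersection of the empty family is \<open>UNIV\<close>, which need not be
    clopen in \<open>Y\<close>; hence the claim is about a member of the filter below the
    intersection.\<close>
  have fip: "\<exists>V \<in> ?F. V \<subseteq> \<Inter>G" if "finite G" "G \<subseteq> ?F" for G
    using that
  proof (induction G rule: finite_induct)
    case empty
    show ?case using p_top top by auto
  next
    case (insert U G)
    then obtain V where V: "V \<in> clopens Y" "p V" "V \<subseteq> \<Inter>G" by blast
    have U: "U \<in> clopens Y" "p U" using insert.prems by auto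
    have "U \<inter> V \<in> ?F" using Int[OF U(1) V(1)] p_Int[OF U(1) V(1)] U V by simp
    then show ?case using V by blast
  qed
  have "\<Inter>G \<noteq> {}" if G: "finite G" "G \<subseteq> ?F" for G
  proof -
    obtain V where V: "V \<in> clopens Y" "p V" "V \<subseteq> \<Inter>G" using fip[OF G] by blast
    then have "V \<noteq> {}" using p_empty by metis
    then show ?thesis using V(3) by blast
  qed
  moreover have "\<forall>U \<in> ?F. closedin Y U" by (simp add: clopensD)
  ultimately have "\<Inter>?F \<noteq> {}"
    using Y unfolding compact_space_fip by meson
  then obtain y where y: "\<And>U. \<lbrakk>U \<in> clopens Y; p U\<rbrakk> \<Longrightarrow> y \<in> U" by blast
  then have yY: "y \<in> topspace Y" using p_top top by auto
  have "p U" if U: "U \<in> clopens Y" "y \<in> U" for U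
  proof (rule ccontr)
    assume "\<not> p U"
    moreover have "U \<union> (topspace Y - U) = topspace Y" using U clopensD by fastforce
    ultimately have "p (topspace Y - U)"
      using p_Un[OF U(1) compl_sets[OF U(1)]] p_top by simp
    then show False using y[OF compl_sets[OF U(1)]] U by auto
  qed
  then show ?thesis using y yY by blast
qed

section \<open>Stone spaces\<close>

text \<open>The failure of a homomorphism law is visible at no more than three arguments, and
  agreement with a given function at finitely many arguments is an open condition in a product of
  discrete spaces.\<close>

lemma closedin_boolean_homs:
  assumes A: "boolean_lattice A"
  shows "closedin (product_topology (\<lambda>_. discrete_topology UNIV) (carrier A)) (boolean_hom A two)"
    (is "closedin ?Q ?P")
proof -
  have sub: "?P \<subseteq> topspace ?Q" by (auto simp: boolean_hom_def)
  have nbhd: "openin ?Q {q \<in> topspace ?Q. \<forall>b \<in> B. q b = p b}" if "finite B" "B \<subseteq> carrier A" for B p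
    using that
  proof (induction B rule: finite_induct)
    case (insert b B)
    have "openin ?Q {q \<in> topspace ?Q. q b \<in> {p b}}"
      using insert by (intro openin_continuous_map_preimage[OF continuous_map_product_projection]) auto
    then have "openin ?Q ({q \<in> topspace ?Q. q b \<in> {p b}} \<inter> {q \<in> topspace ?Q. \<forall>b \<in> B. q b = p b})"
      using insert by auto
    moreover have "{q \<in> topspace ?Q. q b \<in> {p b}} \<inter> {q \<in> topspace ?Q. \<forall>b \<in> B. q b = p b} =
        {q \<in> topspace ?Q. \<forall>b \<in> insert b B. q b = p b}" by auto
    ultimately show ?case by simp
  next
    case empty
    show ?case using openin_topspace[of ?Q] by simp
  qed
  have witness: "\<exists>B. finite B \<and> B \<subseteq> carrier A \<and> (\<forall>q \<in> ?P. \<exists>b \<in> B. q b \<noteq> p b)"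
    if p: "p \<in> topspace ?Q - ?P" for p
  proof -
    note iff = boolean_hom_two_iff[OF boolean_lattice_imp_lattice[OF A]]
    note closed = boolean_lattice_closed[OF A]
    have "p \<in> extensional (carrier A)" using p by (simp add: PiE_iff)
    then consider
        (join) a b where "a \<in> carrier A" "b \<in> carrier A" "p (a \<squnion>\<^bsub>A\<^esub> b) \<noteq> (p a \<or> p b)"
      | (meet) a b where "a \<in> carrier A" "b \<in> carrier A" "p (a \<sqinter>\<^bsub>A\<^esub> b) \<noteq> (p a \<and> p b)"
      | (bottom) "p \<bottom>\<^bsub>A\<^esub>" | (top) "\<not> p \<top>\<^bsub>A\<^esub>"
      using p unfolding iff Diff_iff by blast
    then show ?thesis
    proof cases
      case join
      have "\<exists>c \<in> {a, b, a \<squnion>\<^bsub>A\<^esub> b}. q c \<noteq> p c" if "q \<in> ?P" for q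
        using boolean_homD(5)[OF that join(1,2)] join(3) by auto
      then show ?thesis
        using closed join by (intro exI[of _ "{a, b, a \<squnion>\<^bsub>A\<^esub> b}"]) simp
    next
      case meet
      have "\<exists>c \<in> {a, b, a \<sqinter>\<^bsub>A\<^esub> b}. q c \<noteq> p c" if "q \<in> ?P" for q
        using boolean_homD(6)[OF that meet(1,2)] meet(3) by auto
      then show ?thesis
        using closed meet by (intro exI[of _ "{a, b, a \<sqinter>\<^bsub>A\<^esub> b}"]) simp
    next
      case bottom
      have *: "\<exists>c \<in> {\<bottom>\<^bsub>A\<^esub>}. q c \<noteq> p c" if "q \<in> ?P" for q
        using boolean_homD(7)[OF that] bottom by simp
      show ?thesis
        by (intro exI[of _ "{\<bottom>\<^bsub>A\<^esub>}"] conjI ballI *) (simp_all add: closed)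
    next
      case top
      have *: "\<exists>c \<in> {\<top>\<^bsub>A\<^esub>}. q c \<noteq> p c" if "q \<in> ?P" for q
        using boolean_homD(8)[OF that] top by simp
      show ?thesis
        by (intro exI[of _ "{\<top>\<^bsub>A\<^esub>}"] conjI ballI *) (simp_all add: closed)
    qed
  qed
  have "\<exists>T. openin ?Q T \<and> p \<in> T \<and> T \<subseteq> topspace ?Q - ?P" if p: "p \<in> topspace ?Q - ?P" for p
  proof -
    obtain B where "finite B" "B \<subseteq> carrier A" "\<forall>q \<in> ?P. \<exists>b \<in> B. q b \<noteq> p b"
      using witness[OF p] by blast
    then show ?thesis
      using nbhd[of B p] p by (intro exI[of _ "{q \<in> topspace ?Q. \<forall>b \<in> B. q b = p b}"]) blast
  qed
  then have "openin ?Q (topspace ?Q - ?P)" by (subst openin_subopen) blast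
  then show ?thesis using sub by (simp add: closedin_def)
qed

text \<open>The points have to be elements of \<open>'u\<close>. An injection \<open>i\<close>
  exists because a homomorphism is determined by the subset of the carrier on which it is true. The
  description of the clopen sets later gives surjectivity of the map from \<open>A\<close> to the
  clopen algebra.\<close>

lemma stone_space:
  fixes A :: "'u gorder"
  assumes U: "power_closed_universe TYPE('u)" and small_A: "small (carrier A)"
    and A: "boolean_lattice A"
  obtains Y :: "'u topology" and i where
    "small (topspace Y)" "compact_space Y" "Hausdorff_space Y" "zero_dimensional Y"
    "bij_betw i (boolean_hom A two) (topspace Y)"
    "clopens Y = (\<lambda>a. i ` {p \<in> boolean_hom A two. p a}) ` carrier A"
proof -
  let ?P = "boolean_hom A two"
  define Q :: "('u \<Rightarrow> bool) topology" where
    "Q = product_topology (\<lambda>_. discrete_topology UNIV) (carrier A)"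
  let ?E = "\<lambda>a. {p \<in> ?P. p a}"
  note closed = boolean_lattice_closed[OF A]
  have ext_eq: "p = q" if "p \<in> ?P" "q \<in> ?P" "\<And>a. a \<in> carrier A \<Longrightarrow> p a = q a" for p q
    using that boolean_homD(3)[of _ A two] extensionalityI[of p "carrier A" q] by blast
  have "inj_on (\<lambda>p. {a \<in> carrier A. p a}) ?P"
  proof (rule inj_onI)
    fix p q assume pq: "p \<in> ?P" "q \<in> ?P" "{a \<in> carrier A. p a} = {a \<in> carrier A. q a}"
    then have "p a = q a" if "a \<in> carrier A" for a using that by blast
    then show "p = q" using ext_eq pq by blast
  qed
  then have "?P \<lesssim> Pow (carrier A)" unfolding lepoll_def by blast
  then have small_P: "?P \<prec> (UNIV :: 'u set)"
    using U small_A unfolding power_closed_universe_def by (blast intro: lesspoll_trans1)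
  then obtain i :: "('u \<Rightarrow> bool) \<Rightarrow> 'u" where i: "inj_on i ?P"
    using lesspoll_imp_lepoll unfolding lepoll_def by blast
  have i_mem: "i p \<in> i ` V \<longleftrightarrow> p \<in> V" if "p \<in> ?P" "V \<subseteq> ?P" for p V
    using that inj_on_image_mem_iff[OF i] by blast
  have QP: "closedin Q ?P" unfolding Q_def by (rule closedin_boolean_homs[OF A])
  then have sub: "?P \<subseteq> topspace Q" by (rule closedin_subset)
  have "compact_space Q"
    unfolding Q_def by (simp add: compact_space_product_topology compact_space_discrete_topology)
  then have cpt: "compact_space (subtopology Q ?P)"
    by (intro compact_space_subtopology closedin_compact_space QP)
  \<comment> \<open>The topology of the homomorphism space is carried over to the image of
    \<open>i\<close>; its open sets are the images of open sets.\<close>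
  define Y where "Y = pullback_topology (i ` ?P) (inv_into ?P i) (subtopology Q ?P)"
  have top: "topspace (subtopology Q ?P) = ?P" using sub by auto
  then have Y: "topspace Y = i ` ?P"
    using i by (auto simp: Y_def topspace_pullback_topology)
  have open_Y: "openin Y W \<longleftrightarrow> (\<exists>V. openin (subtopology Q ?P) V \<and> W = i ` V)" for W
  proof -
    have "inv_into ?P i -` V \<inter> i ` ?P = i ` V" if "openin (subtopology Q ?P) V" for V
    proof -
      have "V \<subseteq> ?P" using openin_subset[OF that] top by simp
      then show ?thesis using i by (auto simp: subset_iff)
    qed
    then show ?thesis unfolding Y_def openin_pullback_topology by metis
  qed
  \<comment> \<open>Continuity of \<open>i\<close> is wanted for the compactness of its
    image.\<close>
  have "continuous_map (subtopology Q ?P) Y i"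
    unfolding continuous_map top Y open_Y
  proof (intro conjI allI impI order_refl)
    fix W assume "\<exists>V. openin (subtopology Q ?P) V \<and> W = i ` V"
    then obtain V where V: "openin (subtopology Q ?P) V" "W = i ` V" by blast
    then have VP: "V \<subseteq> ?P" using openin_subset top by metis
    have "{p \<in> ?P. i p \<in> W} = V" using i_mem[OF _ VP] VP V(2) by blast
    then show "openin (subtopology Q ?P) {p \<in> ?P. i p \<in> W}" using V by simp
  qed
  then have cpt_Y: "compact_space Y"
    using image_compactin[of "subtopology Q ?P" ?P Y i] cpt top Y by (simp add: compact_space_def)
  define M where "M = (\<lambda>a. i ` ?E a) ` carrier A"
  have alg: "algebra (topspace Y) M"
    unfolding algebra_iff_Int
  proof (intro conjI ballI)
    show "M \<subseteq> Pow (topspace Y)" by (auto simp: M_def Y)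
    have "?E \<bottom>\<^bsub>A\<^esub> = {}" using boolean_homD(7) by fastforce
    then show "{} \<in> M" unfolding M_def using closed by (intro image_eqI[of _ _ "\<bottom>\<^bsub>A\<^esub>"]) auto
  next
    fix W assume "W \<in> M"
    then obtain a where a: "a \<in> carrier A" "W = i ` ?E a" by (auto simp: M_def)
    obtain b where b: "b \<in> carrier A" "a \<squnion>\<^bsub>A\<^esub> b = \<top>\<^bsub>A\<^esub>" "a \<sqinter>\<^bsub>A\<^esub> b = \<bottom>\<^bsub>A\<^esub>"
      using boolean_lattice.complemented[OF A a(1)] by blast
    \<comment> \<open>Homomorphisms turn lattice complements into negations, so complements in
      \<open>M\<close> come from complements in \<open>A\<close>.\<close>
    have "p b \<longleftrightarrow> \<not> p a" if "p \<in> ?P" for p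
      using boolean_homD(5-8)[OF that] a b by (metis two_simps(2-5))
    then have "?P - ?E a = ?E b" by blast
    then have "topspace Y - W = i ` ?E b"
      using inj_on_image_set_diff[OF i, of ?P "?E a"] a Y by auto
    then show "topspace Y - W \<in> M" using b by (auto simp: M_def)
  next
    fix V W assume "V \<in> M" "W \<in> M"
    then obtain a b where ab: "a \<in> carrier A" "V = i ` ?E a" "b \<in> carrier A" "W = i ` ?E b"
      by (auto simp: M_def)
    have "p (a \<sqinter>\<^bsub>A\<^esub> b) \<longleftrightarrow> p a \<and> p b" if "p \<in> ?P" for p
      using boolean_homD(6)[OF that] ab by simp
    then have "?E a \<inter> ?E b = ?E (a \<sqinter>\<^bsub>A\<^esub> b)" by blast
    then have "V \<inter> W = i ` ?E (a \<sqinter>\<^bsub>A\<^esub> b)"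
      using inj_on_image_Int[OF i, of "?E a" "?E b"] ab by auto
    then show "V \<inter> W \<in> M" using ab closed by (auto simp: M_def)
  qed
  have open_M: "openin Y W" if W: "W \<in> M" for W
  proof -
    obtain a where a: "a \<in> carrier A" "W = i ` ?E a" using W by (auto simp: M_def)
    have "openin Q {q \<in> topspace Q. q a \<in> {True}}"
      unfolding Q_def
      by (rule openin_continuous_map_preimage[OF continuous_map_product_projection]) (use a in auto)
    then have "openin (subtopology Q ?P) ({q \<in> topspace Q. q a \<in> {True}} \<inter> ?P)"
      by (auto simp: openin_subtopology)
    moreover have "{q \<in> topspace Q. q a \<in> {True}} \<inter> ?P = ?E a" using sub by auto
    ultimately show ?thesis using a by (auto simp: open_Y)
  qed
  have sep: "\<exists>W \<in> M. x \<in> W \<and> y \<notin> W" if xy: "x \<in> topspace Y" "y \<in> topspace Y" "x \<noteq> y" for x y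
  proof -
    obtain p q where pq: "p \<in> ?P" "q \<in> ?P" "x = i p" "y = i q" using xy Y by auto
    then obtain a where a: "a \<in> carrier A" "p a \<noteq> q a" using ext_eq xy by metis
    have W: "i ` ?E a \<in> M" using a by (auto simp: M_def)
    have *: "i r \<in> i ` ?E a \<longleftrightarrow> r a" if "r \<in> ?P" for r
      using i_mem[OF that, of "?E a"] that by auto
    show ?thesis
    proof (cases "p a")
      case True
      then show ?thesis using W * pq a by (intro bexI[of _ "i ` ?E a"]) auto
    next
      \<comment> \<open>Now \<open>q a\<close> holds, so the complement of the set of
        \<open>a\<close> contains \<open>x\<close> and omits \<open>y\<close>.\<close>
      case False
      then show ?thesis
        using algebra.compl_sets[OF alg W] * pq a xy
        by (intro bexI[of _ "topspace Y - i ` ?E a"]) auto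
    qed
  qed
  note Y_props = compact_separating_algebra[OF cpt_Y alg open_M sep]
  have "small (topspace Y)"
    unfolding small_def Y using small_P image_lepoll lesspoll_trans1 by blast
  moreover have "bij_betw i ?P (topspace Y)" using i Y by (simp add: bij_betw_def)
  ultimately show ?thesis
    using that[of Y i] cpt_Y Y_props M_def by blast
qed

section \<open>The category of zero-dimensional compactifications\<close>

lemma embedding_map_imp_continuous_map: "embedding_map X Y c \<Longrightarrow> continuous_map X Y c"
  by (auto simp: embedding_map_def homeomorphic_eq_everything_map continuous_map_in_subtopology)

lemma category_Comp: "category Comp"
proof
  fix a :: "'u compactification" assume a: "a \<in> obj Comp"
  obtain X Y c where [simp]: "a = (X, Y, c)" by (cases a) auto
  have "embedding_map X Y c" using a by (simp add: Comp_def hausdorff_compactification_def)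
  then have "c \<in> topspace X \<rightarrow> topspace Y"
    by (intro continuous_map_funspace embedding_map_imp_continuous_map)
  then show "ident Comp a \<in> arr Comp a a"
    by (auto simp: Comp_def intro: continuous_map_eq[OF continuous_map_id])
next
  fix a b c :: "'u compactification" and f g
  assume a: "a \<in> obj Comp" and "b \<in> obj Comp" "c \<in> obj Comp" and fg: "f \<in> arr Comp a b" "g \<in> arr Comp b c"
  obtain X Y i X' Y' i' X'' Y'' i'' where [simp]: "a = (X, Y, i)" "b = (X', Y', i')" "c = (X'', Y'', i'')"
    by (metis prod_cases3)
  obtain p q p' q' where [simp]: "f = (p, q)" "g = (p', q')" by (meson surj_pair)
  have "continuous_map X X'' (compose (topspace X) p' p)" "continuous_map Y Y'' (compose (topspace Y) q' q)"
    using fg by (auto simp: Comp_def compose_eq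
        intro: continuous_map_eq[OF continuous_map_compose[of X X' p X'' p']]
          continuous_map_eq[OF continuous_map_compose[of Y Y' q Y'' q']])
  moreover have "i \<in> topspace X \<rightarrow> topspace Y"
    using a by (intro continuous_map_funspace embedding_map_imp_continuous_map)
      (simp add: Comp_def hausdorff_compactification_def)
  moreover have "p \<in> topspace X \<rightarrow> topspace X'"
    using fg by (auto simp: Comp_def dest: continuous_map_funspace)
  ultimately show "cmp Comp a b c g f \<in> arr Comp a c"
    using fg by (auto simp: Comp_def compose_eq Pi_iff)
next
  fix a b :: "'u compactification" and f
  assume "a \<in> obj Comp" "b \<in> obj Comp" and f: "f \<in> arr Comp a b"
  obtain X Y i X' Y' i' where [simp]: "a = (X, Y, i)" "b = (X', Y', i')" by (metis prod_cases3)
  obtain p q where [simp]: "f = (p, q)" by (meson surj_pair)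
  have "p \<in> topspace X \<rightarrow> topspace X'" "q \<in> topspace Y \<rightarrow> topspace Y'"
    using f by (auto simp: Comp_def dest: continuous_map_funspace)
  then show "cmp Comp a a b f (ident Comp a) = f" "cmp Comp a b b (ident Comp b) f = f"
    using f by (auto simp: Comp_def compose_restrict_id compose_id_restrict)
next
  fix a b c d :: "'u compactification" and f g h
  assume "a \<in> obj Comp" "b \<in> obj Comp" "c \<in> obj Comp" "d \<in> obj Comp"
    and fgh: "f \<in> arr Comp a b" "g \<in> arr Comp b c" "h \<in> arr Comp c d"
  obtain X Y i X' Y' i' where [simp]: "a = (X, Y, i)" "b = (X', Y', i')" by (metis prod_cases3)
  obtain X2 Y2 i2 X3 Y3 i3 where [simp]: "c = (X2, Y2, i2)" "d = (X3, Y3, i3)" by (metis prod_cases3)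
  obtain p q p' q' p2 q2 where [simp]: "f = (p, q)" "g = (p', q')" "h = (p2, q2)" by (meson surj_pair)
  have "p \<in> topspace X \<rightarrow> topspace X'" "q \<in> topspace Y \<rightarrow> topspace Y'"
    using fgh by (auto simp: Comp_def dest: continuous_map_funspace)
  then show "cmp Comp a c d h (cmp Comp a b c g f) = cmp Comp a b d (cmp Comp b c d h g) f"
    by (simp add: Comp_def compose_assoc)
qed

lemma obj_ZComp:
  "(X, Y, c) \<in> obj ZComp \<longleftrightarrow> small (topspace X) \<and> small (topspace Y) \<and>
     compact_space Y \<and> Hausdorff_space Y \<and> zero_dimensional Y \<and> c \<in> extensional (topspace X) \<and>
     embedding_map X Y c \<and> Abstract_Topology.closure_of Y (c ` topspace X) = topspace Y"
  by (auto simp: ZComp_def full_subcategory_def Comp_def hausdorff_compactification_def)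

lemma arr_ZComp:
  "(f, g) \<in> arr ZComp (X, Y, c) (X', Y', c') \<longleftrightarrow>
     f \<in> extensional (topspace X) \<and> continuous_map X X' f \<and>
     g \<in> extensional (topspace Y) \<and> continuous_map Y Y' g \<and> (\<forall>x \<in> topspace X. g (c x) = c' (f x))"
  by (simp add: ZComp_def full_subcategory_def Comp_def)

lemma cmp_ZComp:
  "cmp ZComp (X, Y, c) B C (f', g') (f, g) = (compose (topspace X) f' f, compose (topspace Y) g' g)"
  by (simp add: ZComp_def full_subcategory_def Comp_def)

lemma ident_ZComp: "ident ZComp (X, Y, c) = (\<lambda>x \<in> topspace X. x, \<lambda>y \<in> topspace Y. y)"
  by (simp add: ZComp_def full_subcategory_def Comp_def)

lemma category_ZComp: "category ZComp"
  unfolding ZComp_def by (rule category_full_subcategory[OF category_Comp])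

section \<open>The clopen algebra of a space\<close>

text \<open>The choice is of an injection only if the clopen sets are no more numerous than \<open>'u\<close>.\<close>

definition code :: "'u topology \<Rightarrow> 'u set \<Rightarrow> 'u" where
  "code Y = (SOME e. inj_on e (clopens Y))"

definition decode :: "'u topology \<Rightarrow> 'u \<Rightarrow> 'u set" where
  "decode Y = inv_into (clopens Y) (code Y)"

definition clopen_algebra :: "'u topology \<Rightarrow> 'u gorder" where
  "clopen_algebra Y = set_lattice (code Y ` clopens Y) (decode Y)"

definition point :: "'u topology \<Rightarrow> 'u \<Rightarrow> 'u \<Rightarrow> bool" where
  "point Y y = (\<lambda>a \<in> carrier (clopen_algebra Y). y \<in> decode Y a)"

definition preimage :: "'u topology \<Rightarrow> 'u topology \<Rightarrow> ('u \<Rightarrow> 'u) \<Rightarrow> 'u \<Rightarrow> 'u" where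
  "preimage Y Y' g =
     (\<lambda>a \<in> carrier (clopen_algebra Y'). code Y {y \<in> topspace Y. g y \<in> decode Y' a})"

lemma point_apply: "a \<in> carrier (clopen_algebra Y) \<Longrightarrow> point Y y a \<longleftrightarrow> y \<in> decode Y a"
  by (simp add: point_def)

context
  fixes universe :: "'u itself"
  assumes universe: "power_closed_universe TYPE('u)"
begin

text \<open>The assumption on the universe enters the coding of clopen sets here: it makes
  \<open>code\<close> injective and the clopen algebra small.\<close>

lemma clopens_lesspoll:
  fixes Y :: "'u topology"
  assumes "small (topspace Y)"
  shows "clopens Y \<prec> (UNIV :: 'u set)"
proof -
  have "clopens Y \<lesssim> Pow (topspace Y)" by (intro subset_imp_lepoll) (auto dest: clopensD)
  then show ?thesis
    using universe assms unfolding power_closed_universe_def by (blast intro: lesspoll_trans1)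
qed

section \<open>The clopen algebra of one small space\<close>

context
  fixes Y :: "'u topology"
  assumes small_Y: "small (topspace Y)"
begin

lemma inj_on_code: "inj_on (code Y) (clopens Y)"
proof -
  have "\<exists>e :: 'u set \<Rightarrow> 'u. inj_on e (clopens Y)"
    using lesspoll_imp_lepoll[OF clopens_lesspoll[OF small_Y]] unfolding lepoll_def by blast
  then show ?thesis unfolding code_def by (rule someI_ex)
qed

lemma code_carrier: "U \<in> clopens Y \<Longrightarrow> code Y U \<in> carrier (clopen_algebra Y)"
  by (simp add: clopen_algebra_def)

lemma decode_code: "U \<in> clopens Y \<Longrightarrow> decode Y (code Y U) = U"
  unfolding decode_def by (rule inv_into_f_f[OF inj_on_code])

lemma decode_clopen: "a \<in> carrier (clopen_algebra Y) \<Longrightarrow> decode Y a \<in> clopens Y"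
  by (auto simp: clopen_algebra_def decode_code)

lemma code_decode: "a \<in> carrier (clopen_algebra Y) \<Longrightarrow> code Y (decode Y a) = a"
  by (auto simp: clopen_algebra_def decode_code)

lemma bij_betw_decode: "bij_betw (decode Y) (code Y ` clopens Y) (clopens Y)"
  by (rule bij_betw_byWitness[of _ "code Y"]) (auto simp: decode_code)

lemma small_clopen_algebra: "small (carrier (clopen_algebra Y))"
proof -
  have "code Y ` clopens Y \<lesssim> clopens Y" by (rule image_lepoll)
  then show ?thesis
    unfolding small_def clopen_algebra_def
    using lesspoll_trans1[OF _ clopens_lesspoll[OF small_Y]] by simp
qed

lemma boolean_clopen_algebra: "boolean_lattice (clopen_algebra Y)"
  unfolding clopen_algebra_def by (rule boolean_set_lattice[OF algebra_clopens bij_betw_decode])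

lemma decode_bottom: "decode Y \<bottom>\<^bsub>clopen_algebra Y\<^esub> = {}"
  and decode_top: "decode Y \<top>\<^bsub>clopen_algebra Y\<^esub> = topspace Y"
  unfolding clopen_algebra_def
  by (rule set_lattice_bottom[OF algebra_clopens bij_betw_decode])
    (rule set_lattice_top[OF algebra_clopens bij_betw_decode])

lemma decode_join: "\<lbrakk>a \<in> carrier (clopen_algebra Y); b \<in> carrier (clopen_algebra Y)\<rbrakk>
    \<Longrightarrow> decode Y (a \<squnion>\<^bsub>clopen_algebra Y\<^esub> b) = decode Y a \<union> decode Y b"
  and decode_meet: "\<lbrakk>a \<in> carrier (clopen_algebra Y); b \<in> carrier (clopen_algebra Y)\<rbrakk>
    \<Longrightarrow> decode Y (a \<sqinter>\<^bsub>clopen_algebra Y\<^esub> b) = decode Y a \<inter> decode Y b"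
  unfolding clopen_algebra_def carrier_set_lattice
  by (rule set_lattice_join[OF algebra_clopens bij_betw_decode]; assumption)
    (rule set_lattice_meet[OF algebra_clopens bij_betw_decode]; assumption)

lemmas decode_ops = decode_bottom decode_top decode_join decode_meet

lemma code_ops:
  "code Y {} = \<bottom>\<^bsub>clopen_algebra Y\<^esub>" "code Y (topspace Y) = \<top>\<^bsub>clopen_algebra Y\<^esub>"
  "\<lbrakk>U \<in> clopens Y; V \<in> clopens Y\<rbrakk> \<Longrightarrow> code Y (U \<union> V) = code Y U \<squnion>\<^bsub>clopen_algebra Y\<^esub> code Y V"
  "\<lbrakk>U \<in> clopens Y; V \<in> clopens Y\<rbrakk> \<Longrightarrow> code Y (U \<inter> V) = code Y U \<sqinter>\<^bsub>clopen_algebra Y\<^esub> code Y V"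
proof -
  note closed = boolean_lattice_closed[OF boolean_clopen_algebra]
  show "code Y {} = \<bottom>\<^bsub>clopen_algebra Y\<^esub>" "code Y (topspace Y) = \<top>\<^bsub>clopen_algebra Y\<^esub>"
    using code_decode[OF closed(1)] code_decode[OF closed(2)] by (simp_all add: decode_ops)
  assume UV: "U \<in> clopens Y" "V \<in> clopens Y"
  show "code Y (U \<union> V) = code Y U \<squnion>\<^bsub>clopen_algebra Y\<^esub> code Y V"
    using code_decode[OF closed(3)[OF code_carrier code_carrier]] UV
    by (simp add: decode_ops code_carrier decode_code)
  show "code Y (U \<inter> V) = code Y U \<sqinter>\<^bsub>clopen_algebra Y\<^esub> code Y V"
    using code_decode[OF closed(4)[OF code_carrier code_carrier]] UV
    by (simp add: decode_ops code_carrier decode_code)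
qed

lemma point_hom: "y \<in> topspace Y \<Longrightarrow> point Y y \<in> boolean_hom (clopen_algebra Y) two"
  by (rule boolean_homI)
    (simp_all add: boolean_lattice_imp_lattice boolean_clopen_algebra boolean_two point_def
      boolean_lattice_closed decode_ops)

lemma point_eqD:
  assumes "Hausdorff_space Y" "zero_dimensional Y" "point Y x = point Y y"
    and xy: "x \<in> topspace Y" "y \<in> topspace Y"
  shows "x = y"
proof (rule ccontr)
  assume "x \<noteq> y"
  then obtain U where "U \<in> clopens Y" "x \<in> U" "y \<notin> U"
    using zero_dimensional_separation assms by metis
  then show False
    using fun_cong[OF assms(3), of "code Y U"] by (simp add: point_apply code_carrier decode_code)
qed

text \<open>Through \<open>code\<close> the homomorphism becomes a prime filter of clopen sets,
  which compactness turns into a point.\<close>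

lemma hom_two_eq_point:
  assumes "compact_space Y" and q: "q \<in> boolean_hom (clopen_algebra Y) two"
  shows "\<exists>y \<in> topspace Y. point Y y = q"
proof -
  note hom = boolean_homD[OF q]
  have "\<exists>y \<in> topspace Y. \<forall>U \<in> clopens Y. q (code Y U) \<longleftrightarrow> y \<in> U"
    by (rule clopen_prime_filter_point[OF assms(1)])
      (simp_all add: code_ops code_carrier hom)
  then obtain y where y: "y \<in> topspace Y" "\<And>U. U \<in> clopens Y \<Longrightarrow> q (code Y U) \<longleftrightarrow> y \<in> U"
    by blast
  have "point Y y = q"
  proof (rule extensionalityI[of _ "carrier (clopen_algebra Y)"])
    fix a assume a: "a \<in> carrier (clopen_algebra Y)"
    then show "point Y y a = q a"
      using y(2)[OF decode_clopen[OF a]] by (simp add: point_apply code_decode)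
  qed (simp_all add: point_def hom)
  with y show ?thesis by blast
qed

end

section \<open>Continuous maps and homomorphisms of clopen algebras\<close>

context
  fixes Y Y' :: "'u topology"
  assumes small_Y: "small (topspace Y)" and small_Y': "small (topspace Y')"
begin

lemma clopen_preimage:
  assumes "continuous_map Y Y' g" "a \<in> carrier (clopen_algebra Y')"
  shows "{y \<in> topspace Y. g y \<in> decode Y' a} \<in> clopens Y"
  using decode_clopen[OF small_Y' assms(2)] assms(1)
  by (auto simp: clopens_def intro: openin_continuous_map_preimage closedin_continuous_map_preimage)

lemma preimage_carrier:
  assumes "continuous_map Y Y' g" "a \<in> carrier (clopen_algebra Y')"
  shows "preimage Y Y' g a \<in> carrier (clopen_algebra Y)"
  using code_carrier[OF small_Y clopen_preimage[OF assms]] assms by (simp add: preimage_def)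

lemma decode_preimage:
  assumes "continuous_map Y Y' g" "a \<in> carrier (clopen_algebra Y')"
  shows "decode Y (preimage Y Y' g a) = {y \<in> topspace Y. g y \<in> decode Y' a}"
  using decode_code[OF small_Y clopen_preimage[OF assms]] assms by (simp add: preimage_def)

lemma preimage_hom:
  assumes g: "continuous_map Y Y' g"
  shows "preimage Y Y' g \<in> boolean_hom (clopen_algebra Y') (clopen_algebra Y)"
proof (rule boolean_homI)
  let ?A = "clopen_algebra Y" and ?A' = "clopen_algebra Y'"
  note closed = boolean_lattice_closed[OF boolean_clopen_algebra[OF small_Y]]
  note closed' = boolean_lattice_closed[OF boolean_clopen_algebra[OF small_Y']]
  \<comment> \<open>Elements are compared by decoding, so the laws for joins and meets become
    identities between preimages of sets.\<close>
  have eqI: "a = b" if "decode Y a = decode Y b" "a \<in> carrier ?A" "b \<in> carrier ?A" for a b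
    using that code_decode[OF small_Y] by metis
  note simps = closed closed' decode_preimage[OF g] preimage_carrier[OF g]
    decode_ops[OF small_Y] decode_ops[OF small_Y']
  show "Lattice.lattice ?A" "Lattice.lattice ?A'"
    using boolean_lattice_imp_lattice boolean_clopen_algebra small_Y small_Y' by blast+
  show "preimage Y Y' g \<in> extensional (carrier ?A')" by (simp add: preimage_def)
  show "preimage Y Y' g a \<in> carrier ?A" if "a \<in> carrier ?A'" for a
    by (rule preimage_carrier[OF g that])
  fix a b assume ab: "a \<in> carrier ?A'" "b \<in> carrier ?A'"
  show "preimage Y Y' g (a \<squnion>\<^bsub>?A'\<^esub> b) = preimage Y Y' g a \<squnion>\<^bsub>?A\<^esub> preimage Y Y' g b"
    by (rule eqI) (use ab in \<open>auto simp: simps\<close>)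
  show "preimage Y Y' g (a \<sqinter>\<^bsub>?A'\<^esub> b) = preimage Y Y' g a \<sqinter>\<^bsub>?A\<^esub> preimage Y Y' g b"
    by (rule eqI) (use ab in \<open>auto simp: simps\<close>)
next
  let ?A = "clopen_algebra Y" and ?A' = "clopen_algebra Y'"
  note closed' = boolean_lattice_closed[OF boolean_clopen_algebra[OF small_Y']]
  have "g y \<in> topspace Y'" if "y \<in> topspace Y" for y
    using continuous_map_funspace[OF g] that by blast
  then have "{y \<in> topspace Y. g y \<in> topspace Y'} = topspace Y" by blast
  then show "preimage Y Y' g \<bottom>\<^bsub>?A'\<^esub> = \<bottom>\<^bsub>?A\<^esub>" "preimage Y Y' g \<top>\<^bsub>?A'\<^esub> = \<top>\<^bsub>?A\<^esub>"
    using closed' code_ops[OF small_Y] decode_ops[OF small_Y'] by (simp_all add: preimage_def)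
qed

text \<open>Naturality of evaluation. It translates between homomorphisms and points: since
  evaluations determine points, \<open>g\<close> can be recovered from \<open>preimage\<close>, and
  distinguished homomorphisms can be followed to points.\<close>

lemma point_preimage:
  assumes "continuous_map Y Y' g" "y \<in> topspace Y"
  shows "compose (carrier (clopen_algebra Y')) (point Y y) (preimage Y Y' g) = point Y' (g y)"
  by (rule extensionalityI[of _ "carrier (clopen_algebra Y')"])
    (use assms in \<open>simp_all add: compose_eq point_apply preimage_carrier decode_preimage, simp add: point_def\<close>)

lemma preimage_eqD:
  assumes Y': "Hausdorff_space Y'" "zero_dimensional Y'"
    and g: "continuous_map Y Y' g" "g \<in> extensional (topspace Y)"
    and h: "continuous_map Y Y' h" "h \<in> extensional (topspace Y)"
    and eq: "preimage Y Y' g = preimage Y Y' h"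
  shows "g = h"
proof (rule extensionalityI[OF g(2) h(2)])
  fix y assume y: "y \<in> topspace Y"
  have "point Y' (g y) = point Y' (h y)"
    using point_preimage[OF g(1) y] point_preimage[OF h(1) y] eq by simp
  then show "g y = h y"
    by (rule point_eqD[OF small_Y' Y'])
      (use y continuous_map_funspace[OF g(1)] continuous_map_funspace[OF h(1)] in blast)+
qed

text \<open>Evaluation at \<open>y\<close> after \<open>\<phi>\<close> is a homomorphism to
  \<open>two\<close>, hence evaluation at some point of \<open>Y'\<close>, which is taken as
  \<open>g y\<close>. The preimage of the clopen set coded by \<open>a\<close> is the clopen set
  coded by \<open>\<phi> a\<close>; as clopen sets form a base of \<open>Y'\<close>, this gives
  continuity.\<close>

lemma hom_eq_preimage:
  assumes Y': "compact_space Y'" "zero_dimensional Y'"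
    and \<phi>: "\<phi> \<in> boolean_hom (clopen_algebra Y') (clopen_algebra Y)"
  shows "\<exists>g. continuous_map Y Y' g \<and> g \<in> extensional (topspace Y) \<and> preimage Y Y' g = \<phi>"
proof -
  let ?A = "clopen_algebra Y" and ?A' = "clopen_algebra Y'"
  have "\<exists>y' \<in> topspace Y'. point Y' y' = compose (carrier ?A') (point Y y) \<phi>"
    if y: "y \<in> topspace Y" for y
    using hom_two_eq_point[OF small_Y' Y'(1)]
      boolean_hom_compose[OF boolean_clopen_algebra[OF small_Y'] \<phi> point_hom[OF small_Y y]] by blast
  then obtain g0 where g0: "\<And>y. y \<in> topspace Y \<Longrightarrow> g0 y \<in> topspace Y'"
    "\<And>y. y \<in> topspace Y \<Longrightarrow> point Y' (g0 y) = compose (carrier ?A') (point Y y) \<phi>"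
    by metis
  define g where "g = restrict g0 (topspace Y)"
  have mem: "g y \<in> decode Y' a \<longleftrightarrow> y \<in> decode Y (\<phi> a)"
    if "y \<in> topspace Y" "a \<in> carrier ?A'" for y a
    using fun_cong[OF g0(2)[OF that(1)], of a] that boolean_homD(4)[OF \<phi>]
    by (simp add: g_def point_apply compose_eq)
  have eq: "{y \<in> topspace Y. g y \<in> decode Y' a} = decode Y (\<phi> a)" if a: "a \<in> carrier ?A'" for a
    using mem[OF _ a] clopensD(3)[OF decode_clopen[OF small_Y boolean_homD(4)[OF \<phi> a]]] by blast
  have g: "continuous_map Y Y' g"
  proof (rule continuous_map_clopenI[OF Y'(2)])
    show "g y \<in> topspace Y'" if "y \<in> topspace Y" for y
      using that g0 by (simp add: g_def)
    fix U assume U: "U \<in> clopens Y'"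
    note a = code_carrier[OF small_Y' U]
    have "{y \<in> topspace Y. g y \<in> U} = decode Y (\<phi> (code Y' U))"
      using eq[OF a] by (simp add: decode_code[OF small_Y' U])
    then show "openin Y {y \<in> topspace Y. g y \<in> U}"
      using clopensD(1)[OF decode_clopen[OF small_Y boolean_homD(4)[OF \<phi> a]]] by simp
  qed
  have "preimage Y Y' g = \<phi>"
    by (rule extensionalityI[of _ "carrier ?A'"])
      (simp_all add: preimage_def eq code_decode[OF small_Y] boolean_homD[OF \<phi>])
  then show ?thesis using g by (intro exI[of _ g]) (simp add: g_def)
qed

end

lemma preimage_id:
  fixes Y :: "'u topology"
  assumes Y: "small (topspace Y)"
  shows "preimage Y Y (\<lambda>y \<in> topspace Y. y) = (\<lambda>a \<in> carrier (clopen_algebra Y). a)"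
proof (rule extensionalityI[of _ "carrier (clopen_algebra Y)"])
  fix a assume a: "a \<in> carrier (clopen_algebra Y)"
  have "{y \<in> topspace Y. (\<lambda>y \<in> topspace Y. y) y \<in> decode Y a} = decode Y a"
    using clopensD(3)[OF decode_clopen[OF Y a]] by auto
  then show "preimage Y Y (\<lambda>y \<in> topspace Y. y) a = (\<lambda>a \<in> carrier (clopen_algebra Y). a) a"
    using a by (simp only: preimage_def restrict_apply' code_decode[OF Y])
qed (simp_all add: preimage_def)

lemma preimage_compose:
  fixes Y Y' Y'' :: "'u topology"
  assumes "small (topspace Y)" "small (topspace Y')" "small (topspace Y'')"
    and g: "continuous_map Y Y' g" and g': "continuous_map Y' Y'' g'"
  shows "preimage Y Y'' (compose (topspace Y) g' g) =
    compose (carrier (clopen_algebra Y'')) (preimage Y Y' g) (preimage Y' Y'' g')"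
proof (rule extensionalityI[of _ "carrier (clopen_algebra Y'')"])
  fix a assume a: "a \<in> carrier (clopen_algebra Y'')"
  have "{y \<in> topspace Y. compose (topspace Y) g' g y \<in> decode Y'' a} =
      {y \<in> topspace Y. g y \<in> decode Y' (preimage Y' Y'' g' a)}"
    using continuous_map_funspace[OF g] decode_preimage[OF assms(2,3) g' a] by (auto simp: compose_eq)
  then show "preimage Y Y'' (compose (topspace Y) g' g) a =
      compose (carrier (clopen_algebra Y'')) (preimage Y Y' g) (preimage Y' Y'' g') a"
    using a preimage_carrier[OF assms(2,3) g' a] by (simp add: preimage_def compose_eq)
qed (simp_all add: preimage_def)


section \<open>The clopen functor\<close>

text \<open>On second components, precomposition sends evaluation at \<open>c x\<close> to
  evaluation at \<open>c' (f x)\<close>; this is how \<open>f\<close> is recorded.\<close>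

definition clopen_functor ::
    "('u compactification, ('u \<Rightarrow> 'u) \<times> ('u \<Rightarrow> 'u),
      'u zalgebra, ('u \<Rightarrow> 'u) \<times> (('u \<Rightarrow> bool) \<Rightarrow> ('u \<Rightarrow> bool))) functor_data" where
  "clopen_functor = \<lparr>
     on_obj = (\<lambda>(X, Y, c). (clopen_algebra Y, (\<lambda>x. point Y (c x)) ` topspace X)),
     on_arr = (\<lambda>(X, Y, c) (X', Y', c') (f, g).
       (preimage Y Y' g,
        \<lambda>p \<in> (\<lambda>x. point Y (c x)) ` topspace X. compose (carrier (clopen_algebra Y')) p (preimage Y Y' g)))\<rparr>"

lemma on_obj_clopen_functor:
  "on_obj clopen_functor (X, Y, c) = (clopen_algebra Y, (\<lambda>x. point Y (c x)) ` topspace X)"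
  by (simp add: clopen_functor_def)

lemma on_arr_clopen_functor:
  "on_arr clopen_functor (X, Y, c) (X', Y', c') (f, g) =
     (preimage Y Y' g,
      \<lambda>p \<in> (\<lambda>x. point Y (c x)) ` topspace X. compose (carrier (clopen_algebra Y')) p (preimage Y Y' g))"
  by (simp add: clopen_functor_def)

lemma on_obj_clopen_functor_obj:
  assumes "(X, Y, c) \<in> obj ZComp"
  shows "on_obj clopen_functor (X, Y, c) \<in> obj zBoole"
proof -
  have small: "small (topspace Y)" and dense: "Abstract_Topology.closure_of Y (c ` topspace X) = topspace Y"
    and c: "continuous_map X Y c"
    using assms embedding_map_imp_continuous_map by (auto simp: obj_ZComp)
  have "\<exists>x \<in> topspace X. point Y (c x) a"
    if a: "a \<in> carrier (clopen_algebra Y)" "a \<noteq> \<bottom>\<^bsub>clopen_algebra Y\<^esub>" for a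
  proof -
    have "decode Y a \<noteq> {}"
      using a code_decode[OF small] code_ops(1)[OF small] by metis
    moreover have "openin Y (decode Y a)" by (rule clopensD(1)[OF decode_clopen[OF small a(1)]])
    ultimately have "c ` topspace X \<inter> decode Y a \<noteq> {}"
      using dense unfolding dense_intersects_open by blast
    then show ?thesis using a by (auto simp: point_apply)
  qed
  then show ?thesis
    using continuous_map_funspace[OF c]
    by (auto simp: on_obj_clopen_functor obj_zBoole small small_clopen_algebra boolean_clopen_algebra
        intro!: point_hom)
qed

lemma on_arr_clopen_functor_arr:
  assumes a: "(X, Y, c) \<in> obj ZComp" and b: "(X', Y', c') \<in> obj ZComp"
    and fg: "(f, g) \<in> arr ZComp (X, Y, c) (X', Y', c')"
  shows "on_arr clopen_functor (X, Y, c) (X', Y', c') (f, g) \<in>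
    arr zBoole (on_obj clopen_functor (X', Y', c')) (on_obj clopen_functor (X, Y, c))"
proof -
  have small: "small (topspace Y)" "small (topspace Y')" and c: "c \<in> topspace X \<rightarrow> topspace Y"
    using a b continuous_map_funspace[OF embedding_map_imp_continuous_map] by (auto simp: obj_ZComp)
  have f: "f \<in> topspace X \<rightarrow> topspace X'" and g: "continuous_map Y Y' g"
    and gc: "\<And>x. x \<in> topspace X \<Longrightarrow> g (c x) = c' (f x)"
    using fg continuous_map_funspace[of X X' f] by (auto simp: arr_ZComp)
  have "compose (carrier (clopen_algebra Y')) (point Y (c x)) (preimage Y Y' g) = point Y' (c' (f x))"
    if "x \<in> topspace X" for x
    using point_preimage[OF small g, of "c x"] c gc that by auto
  then show ?thesis
    using f preimage_hom[OF small g]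
    by (auto simp: on_obj_clopen_functor on_arr_clopen_functor arr_zBoole)
qed

lemma contravariant_clopen_functor: "contravariant_functor ZComp zBoole clopen_functor"
proof -
  have id: "on_arr clopen_functor a a (ident ZComp a) = ident zBoole (on_obj clopen_functor a)"
    if a: "a \<in> obj ZComp" for a
  proof -
    obtain X Y c where [simp]: "a = (X, Y, c)" by (metis prod_cases3)
    have small: "small (topspace Y)" using a by (simp add: obj_ZComp)
    have "compose (carrier (clopen_algebra Y)) (point Y y) (\<lambda>a \<in> carrier (clopen_algebra Y). a) = point Y y"
      for y
      by (rule compose_restrict_id) (simp add: point_def)
    then show ?thesis
      by (auto simp: on_arr_clopen_functor on_obj_clopen_functor ident_ZComp ident_zBoole
          preimage_id[OF small] intro!: restrict_ext)
  qed
  have cmp: "on_arr clopen_functor a c (cmp ZComp a b c g f) =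
      cmp zBoole (on_obj clopen_functor c) (on_obj clopen_functor b) (on_obj clopen_functor a)
        (on_arr clopen_functor a b f) (on_arr clopen_functor b c g)"
    if abc: "a \<in> obj ZComp" "b \<in> obj ZComp" "c \<in> obj ZComp"
      and fg: "f \<in> arr ZComp a b" "g \<in> arr ZComp b c" for a b c f g
  proof -
    obtain X Y i X' Y' i' X'' Y'' i'' where
      [simp]: "a = (X, Y, i)" "b = (X', Y', i')" "c = (X'', Y'', i'')" by (metis prod_cases3)
    obtain p q p' q' where [simp]: "f = (p, q)" "g = (p', q')" by (meson surj_pair)
    have q: "continuous_map Y Y' q" "continuous_map Y' Y'' q'" using fg by (auto simp: arr_ZComp)
    have small: "small (topspace Y)" "small (topspace Y')" "small (topspace Y'')"
      using abc by (auto simp: obj_ZComp)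
    note pre = preimage_compose[OF small q]
    \<comment> \<open>Once both sides are known to be arrows between the same objects, equality of
      their homomorphisms suffices and second components need no computation.\<close>
    have "on_arr clopen_functor a c (cmp ZComp a b c g f) \<in>
        arr zBoole (on_obj clopen_functor c) (on_obj clopen_functor a)"
      using category.cmp_arr[OF category_ZComp abc fg] on_arr_clopen_functor_arr abc
      by (simp add: cmp_ZComp)
    moreover have "cmp zBoole (on_obj clopen_functor c) (on_obj clopen_functor b) (on_obj clopen_functor a)
        (on_arr clopen_functor a b f) (on_arr clopen_functor b c g) \<in>
        arr zBoole (on_obj clopen_functor c) (on_obj clopen_functor a)"
      using abc fg
      by (intro category.cmp_arr[OF category_zBoole])
        (simp_all add: on_obj_clopen_functor_obj on_arr_clopen_functor_arr)
    ultimately show ?thesis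
      by (auto simp: on_obj_clopen_functor on_arr_clopen_functor cmp_ZComp cmp_zBoole pre
          intro: zBoole_arr_eqI)
  qed
  show ?thesis
    unfolding contravariant_functor_def
    using on_obj_clopen_functor_obj on_arr_clopen_functor_arr id cmp by auto
qed

lemma fully_faithful_clopen_functor:
  assumes a: "a \<in> obj ZComp" and b: "b \<in> obj ZComp"
    and h: "h \<in> arr zBoole (on_obj clopen_functor b) (on_obj clopen_functor a)"
  shows "\<exists>!f. f \<in> arr ZComp a b \<and> on_arr clopen_functor a b f = h"
proof -
  obtain X Y c X' Y' c' where [simp]: "a = (X, Y, c)" "b = (X', Y', c')" by (metis prod_cases3)
  obtain \<phi> k where [simp]: "h = (\<phi>, k)" by (meson surj_pair)
  have small: "small (topspace Y)" "small (topspace Y')"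
    and c: "c \<in> topspace X \<rightarrow> topspace Y" and c': "c' \<in> topspace X' \<rightarrow> topspace Y'"
    and emb: "embedding_map X Y c" "embedding_map X' Y' c'"
    and Y': "compact_space Y'" "Hausdorff_space Y'" "zero_dimensional Y'"
    using a b continuous_map_funspace[OF embedding_map_imp_continuous_map] by (auto simp: obj_ZComp)
  have inj_c': "inj_on c' (topspace X')"
    using emb(2) by (simp add: embedding_map_def homeomorphic_eq_everything_map)
  have \<phi>: "\<phi> \<in> boolean_hom (clopen_algebra Y') (clopen_algebra Y)"
    and k: "\<And>x. x \<in> topspace X \<Longrightarrow> k (point Y (c x)) \<in> (\<lambda>x. point Y' (c' x)) ` topspace X'"
      "\<And>x. x \<in> topspace X \<Longrightarrow>
        compose (carrier (clopen_algebra Y')) (point Y (c x)) \<phi> = k (point Y (c x))"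
    using h by (auto simp: on_obj_clopen_functor arr_zBoole)
  obtain g where g: "continuous_map Y Y' g" "g \<in> extensional (topspace Y)" "preimage Y Y' g = \<phi>"
    using hom_eq_preimage[OF small Y'(1,3) \<phi>] by blast
  \<comment> \<open>Evaluation at \<open>g (c x)\<close> is the image of a distinguished
    homomorphism under \<open>k\<close>, hence equals evaluation at some \<open>c' x'\<close>;
    evaluations determine points.\<close>
  have "\<exists>x' \<in> topspace X'. g (c x) = c' x'" if x: "x \<in> topspace X" for x
  proof -
    obtain x' where x': "x' \<in> topspace X'" "k (point Y (c x)) = point Y' (c' x')"
      using k(1)[OF x] by blast
    have "point Y' (g (c x)) = point Y' (c' x')"
      using point_preimage[OF small g(1) funcset_mem[OF c x]] k(2)[OF x] x'(2) g(3) by simp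
    then have "g (c x) = c' x'"
      by (rule point_eqD[OF small(2) Y'(2,3)])
        (use x x' c c' continuous_map_funspace[OF g(1)] in blast)+
    then show ?thesis using x' by blast
  qed
  then obtain f0 where f0: "\<And>x. x \<in> topspace X \<Longrightarrow> f0 x \<in> topspace X' \<and> g (c x) = c' (f0 x)"
    by metis
  define f where "f = restrict f0 (topspace X)"
  have f: "f \<in> topspace X \<rightarrow> topspace X'" "\<And>x. x \<in> topspace X \<Longrightarrow> g (c x) = c' (f x)"
    using f0 by (auto simp: f_def)
  \<comment> \<open>On the image of \<open>c'\<close> its inverse \<open>r\<close> is continuous,
    and \<open>f\<close> is the composite of \<open>c\<close>, \<open>g\<close> and
    \<open>r\<close>.\<close>
  have "continuous_map X X' f"
  proof -
    have "continuous_map X Y' (g \<circ> c)"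
      by (rule continuous_map_compose[OF embedding_map_imp_continuous_map[OF emb(1)] g(1)])
    then have "continuous_map X (subtopology Y' (c' ` topspace X')) (g \<circ> c)"
      using f by (auto simp: continuous_map_in_subtopology)
    moreover obtain r where r: "homeomorphic_maps X' (subtopology Y' (c' ` topspace X')) c' r"
      using emb(2) unfolding embedding_map_def homeomorphic_map_maps by blast
    ultimately have "continuous_map X X' (r \<circ> (g \<circ> c))"
      by (auto simp: homeomorphic_maps_def intro: continuous_map_compose)
    moreover have "(r \<circ> (g \<circ> c)) x = f x" if "x \<in> topspace X" for x
      using r f that by (auto simp: homeomorphic_maps_def)
    ultimately show ?thesis by (rule continuous_map_eq)
  qed
  then have fg: "(f, g) \<in> arr ZComp a b"
    using g f by (simp add: arr_ZComp f_def)
  have eq: "on_arr clopen_functor a b (f, g) = h"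
  proof -
    have "on_arr clopen_functor a b (f, g) \<in> arr zBoole (on_obj clopen_functor b) (on_obj clopen_functor a)"
      using on_arr_clopen_functor_arr a b fg by simp
    then show ?thesis
      using h by (auto simp: on_obj_clopen_functor on_arr_clopen_functor g(3) intro: zBoole_arr_eqI)
  qed
  have "f' = (f, g)" if f': "f' \<in> arr ZComp a b" "on_arr clopen_functor a b f' = h" for f'
  proof -
    obtain p q where [simp]: "f' = (p, q)" by (meson surj_pair)
    have pq: "p \<in> extensional (topspace X)" "continuous_map X X' p" "continuous_map Y Y' q"
      "q \<in> extensional (topspace Y)" "\<And>x. x \<in> topspace X \<Longrightarrow> q (c x) = c' (p x)"
      using f' by (auto simp: arr_ZComp)
    \<comment> \<open>Uniqueness of the map on \<open>Y\<close> follows from faithfulness of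
      \<open>preimage\<close>, and uniqueness of the map on \<open>X\<close> from injectivity of
      \<open>c'\<close>.\<close>
    have "q = g"
      by (rule preimage_eqD[OF small Y'(2,3) pq(3,4) g(1,2)])
        (use f'(2) g(3) in \<open>simp add: on_arr_clopen_functor\<close>)
    have "p = f"
    proof (rule extensionalityI[OF pq(1)])
      show "f \<in> extensional (topspace X)" by (simp add: f_def)
      fix x assume x: "x \<in> topspace X"
      have "c' (p x) = c' (f x)" using pq(5)[OF x] f(2)[OF x] \<open>q = g\<close> by simp
      then show "p x = f x"
        by (rule inj_onD[OF inj_c']) (use x f(1) continuous_map_funspace[OF pq(2)] in blast)+
    qed
    with \<open>q = g\<close> show ?thesis by simp
  qed
  then show ?thesis using fg eq by blast
qed

lemma essentially_surjective_clopen_functor: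
  fixes d :: "'u zalgebra"
  assumes d: "d \<in> obj zBoole"
  shows "\<exists>a \<in> obj ZComp. \<exists>e. isomorphism zBoole (on_obj clopen_functor a) d e"
proof -
  obtain A X where [simp]: "d = (A, X)" by force
  have small_A: "small (carrier A)" and A: "boolean_lattice A" and X: "X \<subseteq> boolean_hom A two"
    and nz: "\<And>a. \<lbrakk>a \<in> carrier A; a \<noteq> \<bottom>\<^bsub>A\<^esub>\<rbrakk> \<Longrightarrow> \<exists>x \<in> X. x a"
    using d by (auto simp: obj_zBoole)
  let ?P = "boolean_hom A two"
  obtain Y :: "'u topology" and i where
    small: "small (topspace Y)" and Y: "compact_space Y" "Hausdorff_space Y" "zero_dimensional Y"
    and i: "bij_betw i ?P (topspace Y)"
    and clopens_Y: "clopens Y = (\<lambda>a. i ` {p \<in> ?P. p a}) ` carrier A"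
    using stone_space[OF universe small_A A] by blast
  let ?E = "\<lambda>a. {p \<in> ?P. p a}" and ?B = "clopen_algebra Y"
  have inj_i: "inj_on i ?P" and i_top: "i ` ?P = topspace Y"
    using i by (auto simp: bij_betw_def)
  note closed = boolean_lattice_closed[OF A]
  have clopen: "i ` ?E a \<in> clopens Y" if "a \<in> carrier A" for a
    using that clopens_Y by blast
  have i_mem: "i p \<in> i ` ?E a \<longleftrightarrow> p a" if "p \<in> ?P" for p a
    using inj_on_image_mem_iff[OF inj_i that, of "?E a"] that by auto
  \<comment> \<open>The Stone map, sending \<open>a\<close> to the set of homomorphisms true at
    \<open>a\<close>, with its values coded in \<open>'u\<close>.\<close>
  define \<phi> where "\<phi> = (\<lambda>a \<in> carrier A. code Y (i ` ?E a))"
  have \<phi>: "\<phi> \<in> boolean_hom A ?B"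
  proof (rule boolean_homI)
    show "Lattice.lattice A" "Lattice.lattice ?B"
      using A boolean_clopen_algebra[OF small] boolean_lattice_imp_lattice by blast+
    show "\<phi> \<in> extensional (carrier A)" by (simp add: \<phi>_def)
    show "\<phi> a \<in> carrier ?B" if "a \<in> carrier A" for a
      using code_carrier[OF small clopen[OF that]] that by (simp add: \<phi>_def)
    have E_bottom: "?E \<bottom>\<^bsub>A\<^esub> = {}" using boolean_homD(7) by fastforce
    show "\<phi> \<bottom>\<^bsub>A\<^esub> = \<bottom>\<^bsub>?B\<^esub>"
      using code_ops(1)[OF small] closed(1) by (simp add: \<phi>_def E_bottom del: Collect_empty_eq)
    have E_top: "?E \<top>\<^bsub>A\<^esub> = ?P" using boolean_homD(8) by fastforce
    show "\<phi> \<top>\<^bsub>A\<^esub> = \<top>\<^bsub>?B\<^esub>"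
      using code_ops(2)[OF small] closed(2) by (simp add: \<phi>_def E_top i_top)
    fix a b assume ab: "a \<in> carrier A" "b \<in> carrier A"
    have "p (a \<squnion>\<^bsub>A\<^esub> b) \<longleftrightarrow> p a \<or> p b" if "p \<in> ?P" for p
      using boolean_homD(5)[OF that ab] by simp
    then have "?E (a \<squnion>\<^bsub>A\<^esub> b) = ?E a \<union> ?E b" by blast
    then have "i ` ?E (a \<squnion>\<^bsub>A\<^esub> b) = i ` ?E a \<union> i ` ?E b" by (simp add: image_Un)
    then show "\<phi> (a \<squnion>\<^bsub>A\<^esub> b) = \<phi> a \<squnion>\<^bsub>?B\<^esub> \<phi> b"
      using code_ops(3)[OF small clopen[OF ab(1)] clopen[OF ab(2)]] ab closed(3)[OF ab] by (simp add: \<phi>_def)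
    have "p (a \<sqinter>\<^bsub>A\<^esub> b) \<longleftrightarrow> p a \<and> p b" if "p \<in> ?P" for p
      using boolean_homD(6)[OF that ab] by simp
    then have "?E (a \<sqinter>\<^bsub>A\<^esub> b) = ?E a \<inter> ?E b" by blast
    then have "i ` ?E (a \<sqinter>\<^bsub>A\<^esub> b) = i ` ?E a \<inter> i ` ?E b"
      using inj_on_image_Int[OF inj_i, of "?E a" "?E b"] by auto
    then show "\<phi> (a \<sqinter>\<^bsub>A\<^esub> b) = \<phi> a \<sqinter>\<^bsub>?B\<^esub> \<phi> b"
      using code_ops(4)[OF small clopen[OF ab(1)] clopen[OF ab(2)]] ab closed(4)[OF ab] by (simp add: \<phi>_def)
  qed
  have decode_\<phi>: "decode Y (\<phi> a) = i ` ?E a" if "a \<in> carrier A" for a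
    using decode_code[OF small clopen[OF that]] that by (simp add: \<phi>_def)
  have bij: "bij_betw \<phi> (carrier A) (carrier ?B)"
    unfolding bij_betw_def
  proof
    show "inj_on \<phi> (carrier A)"
    proof (rule inj_onI)
      fix a b assume ab: "a \<in> carrier A" "b \<in> carrier A" "\<phi> a = \<phi> b"
      have E: "i ` ?E a = i ` ?E b"
        using decode_\<phi>[OF ab(1)] decode_\<phi>[OF ab(2)] ab(3) by simp
      \<comment> \<open>Elements with the same clopen set agree under every \<open>p\<close> in
        \<open>X\<close>, and \<open>X\<close> separates elements.\<close>
      have eq: "p a = p b" if "p \<in> X" for p
        using i_mem[OF subsetD[OF X that], of a] i_mem[OF subsetD[OF X that], of b] E by blast
      show "a = b"
        by (rule boolean_lattice_separation[OF A X]) (fact nz ab eq)+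
    qed
    show "\<phi> ` carrier A = carrier ?B"
      by (simp add: \<phi>_def clopen_algebra_def clopens_Y image_image)
  qed
  \<comment> \<open>Pulled back along the Stone map, evaluation at the point of \<open>p\<close> is
    \<open>p\<close> again, so the distinguished homomorphisms on the two sides correspond.\<close>
  have point_\<phi>: "compose (carrier A) (point Y (i p)) \<phi> = p" if p: "p \<in> ?P" for p
    by (rule extensionalityI[of _ "carrier A"])
      (simp_all add: compose_eq point_apply boolean_homD(4)[OF \<phi>] decode_\<phi> i_mem[OF p] boolean_homD(3)[OF p])
  \<comment> \<open>A z-algebra carries no topology on \<open>X\<close>; the one used is induced
    from the Stone space. The inclusion is restricted so that it is \<open>undefined\<close> outside
    its domain.\<close>
  let ?X = "subtopology Y (i ` X)" and ?c = "\<lambda>y \<in> i ` X. y"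
  have iX: "i ` X \<subseteq> topspace Y" using X i_top by blast
  then have top_X: "topspace ?X = i ` X" by auto
  have c_img: "?c ` i ` X = i ` X" by simp
  have "embedding_map ?X Y ?c"
  proof (rule embedding_map_eq)
    show "embedding_map ?X Y id" unfolding embedding_map_def by (simp add: inf.absorb2[OF iX])
  qed (use top_X in auto)
  moreover have "Abstract_Topology.closure_of Y (?c ` topspace ?X) = topspace Y"
    unfolding dense_intersects_open top_X c_img
  proof (intro allI impI)
    \<comment> \<open>A nonempty clopen subset of \<open>T\<close> comes from a nonzero
      \<open>a\<close>. Some \<open>x\<close> in \<open>X\<close> is true at \<open>a\<close>, and
      then \<open>i x\<close> lies in \<open>T\<close>.\<close>
    fix T assume T: "openin Y T \<and> T \<noteq> {}"
    then obtain U y where U: "U \<in> clopens Y" "y \<in> U" "U \<subseteq> T"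
      using Y(3) unfolding zero_dimensional_iff by blast
    then obtain a where a: "a \<in> carrier A" "U = i ` ?E a" using clopens_Y by auto
    obtain p where "p \<in> ?P" "p a" using a U(2) by blast
    then have "a \<noteq> \<bottom>\<^bsub>A\<^esub>" using boolean_homD(7)[of p A two] by auto
    then obtain x where "x \<in> X" "x a" using nz a by blast
    then show "i ` X \<inter> T \<noteq> {}" using a U X by blast
  qed
  moreover have "small (i ` X)"
    using small iX unfolding small_def by (meson lesspoll_trans1 subset_imp_lepoll)
  ultimately have obj: "(?X, Y, ?c) \<in> obj ZComp"
    using small Y top_X by (simp add: obj_ZComp)
  have F: "on_obj clopen_functor (?X, Y, ?c) = (?B, (\<lambda>x. point Y (i x)) ` X)"
    unfolding on_obj_clopen_functor top_X by (auto simp: image_image)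
  have "\<exists>e. isomorphism zBoole (?B, (\<lambda>x. point Y (i x)) ` X) (A, X) e"
  proof (rule isomorphism_zBoole[OF _ _ \<phi> bij])
    show "(A, X) \<in> obj zBoole" using d by simp
    show "(?B, (\<lambda>x. point Y (i x)) ` X) \<in> obj zBoole"
      using on_obj_clopen_functor_obj[OF obj] unfolding F .
    show "(\<lambda>y. compose (carrier A) y \<phi>) ` (\<lambda>x. point Y (i x)) ` X = X"
      unfolding image_image using image_cong[OF refl point_\<phi>[OF subsetD[OF X]], of X] by simp
  qed
  then show ?thesis using obj F by (intro bexI[of _ "(?X, Y, ?c)"]) simp_all
qed

lemma contravariant_equivalence_clopen_functor:
  "contravariant_equivalence ZComp zBoole clopen_functor"
  by (intro contravariant_equivalence.intro contravariant_equivalence_axioms.intro category_ZComp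
      category_zBoole contravariant_clopen_functor fully_faithful_clopen_functor
      essentially_surjective_clopen_functor)

end

theorem theorem8p5:
  assumes "power_closed_universe TYPE('u)"
  shows "dually_equivalent
           (ZComp :: ('u compactification, ('u \<Rightarrow> 'u) \<times> ('u \<Rightarrow> 'u)) cat)
           (zBoole :: ('u zalgebra, ('u \<Rightarrow> 'u) \<times> (('u \<Rightarrow> bool) \<Rightarrow> ('u \<Rightarrow> bool))) cat)"
  by (rule contravariant_equivalence.dually_equivalent
      [OF contravariant_equivalence_clopen_functor[OF assms]])

end
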